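(* Let $K$ and $L$ be compact Hausdorff spaces. Let $T\colon\mathcal{C}(L)\to\mathcal{C}(K)$ be a linear isometry onto a complemented subspace $E$ of $\mathcal{C}(K)$ and let $P\colon\mathcal{C}(K)\to E$ be a norm-$1$ projection onto $E$. Then there exist a closed subset $F$ of $K$, a continuous surjection $\rho\colon F\to L$, and continuous mappings $\sigma\colon F\to\{-1,1\}$ and $\phi\colon L\to S_{\mathcal{M}(F)}$ such that: (i) for each $x\in L$, $\operatorname{supp}(\phi(x))\subseteq\rho^{-1}(x)$; (ii) for each $f\in\mathcal{C}(L)$ and $y\in F$, $T(f)(y)=\sigma(y)f(\rho(y))$; (iii) for each $g\in\mathcal{C}(K)$ and $y\in F$, $P(g)(y)=\sigma(y)\big\langle\phi(\rho(y)),g\big\rangle$. Moreover, (a) if $T$ is positive, then $\sigma(y)=1$ for each $y\in F$; (b) if both $T$ and $P$ are positive, then $\phi(x)\in\mathcal{P}(F)$ for each $x\in L$.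
   Context: $\mathcal{C}(K)$ is the Banach lattice of continuous real functions on $K$ with the sup norm and pointwise order; an operator is positive if it maps nonnegative functions to nonnegative functions. $\mathcal{M}(K)=\mathcal{C}(K)^*$ is the space of regular signed Borel measures on $K$ with the variation norm and $\langle\mu,g\rangle=\int g\,d\mu$. For closed $F\subseteq K$, $\mathcal{M}(F)$ is identified with the measures in $\mathcal{M}(K)$ whose support is contained in $F$; $S_{\mathcal{M}(F)}$ is its unit sphere, endowed with the weak$^*$ topology; $\mathcal{P}(F)\subseteq\mathcal{M}(F)$ is the set of probability measures. $\operatorname{supp}(\mu)$ is the smallest closed set $S$ with $|\mu|$ vanishing on its complement. A projection onto $E$ is a bounded linear operator $P:\mathcal{C}(K)\to E$ with $P\restriction E=\mathrm{id}_E$. *)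

theory Defs
  imports "HOL-Analysis.Analysis"
begin

text \<open>
  For compact \<open>K\<close> every continuous real function is bounded, so the library type
  \<open>'k \<Rightarrow>\<^sub>C real\<close> of bounded continuous functions with the sup norm is the Banach space
  of all continuous real functions on \<open>K\<close>. The library puts no order on this type, so
  positivity is spelled out pointwise.
\<close>

definition positive_operator ::
    "(('a::topological_space \<Rightarrow>\<^sub>C real) \<Rightarrow> ('b::topological_space \<Rightarrow>\<^sub>C real)) \<Rightarrow> bool" where
  "positive_operator T \<longleftrightarrow> (\<forall>f. (\<forall>x. 0 \<le> apply_bcontfun f x) \<longrightarrow> (\<forall>y. 0 \<le> apply_bcontfun (T f) y))"

definition linear_isometry :: "('a::real_normed_vector \<Rightarrow> 'b::real_normed_vector) \<Rightarrow> bool" where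
  "linear_isometry T \<longleftrightarrow> linear T \<and> (\<forall>f. norm (T f) = norm f)"

definition projection_onto :: "'a::real_normed_vector set \<Rightarrow> ('a \<Rightarrow> 'a) \<Rightarrow> bool" where
  "projection_onto E P \<longleftrightarrow> bounded_linear P \<and> range P \<subseteq> E \<and> (\<forall>e\<in>E. P e = e)"

definition complemented_subspace :: "'a::real_normed_vector set \<Rightarrow> bool" where
  "complemented_subspace E \<longleftrightarrow> subspace E \<and> (\<exists>P. projection_onto E P)"


section \<open>Regular signed Borel measures\<close>

text \<open>
  A signed measure is a real-valued set function on the Borel sets. Set functions are total in
  HOL; requiring the value 0 off the Borel sets makes each signed measure one function.
  Countable additivity includes \<open>\<mu> {} = 0\<close>, by the constant sequence \<open>{}\<close>.
\<close>

definition signed_borel_measure :: "('a::topological_space set \<Rightarrow> real) \<Rightarrow> bool" where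
  "signed_borel_measure \<mu> \<longleftrightarrow>
     (\<forall>A :: nat \<Rightarrow> 'a set. range A \<subseteq> sets borel \<longrightarrow> disjoint_family A \<longrightarrow>
        (\<lambda>n. \<mu> (A n)) sums \<mu> (\<Union>n. A n)) \<and>
     (\<forall>A. A \<notin> sets borel \<longrightarrow> \<mu> A = 0)"

text \<open>The value \<open>\<bar>\<mu>\<bar>(A)\<close>: supremum over finite Borel partitions of \<open>A\<close>.\<close>

definition variation :: "('a::topological_space set \<Rightarrow> real) \<Rightarrow> 'a set \<Rightarrow> ennreal" where
  "variation \<mu> A =
     (SUP \<P>\<in>{\<P>. finite \<P> \<and> disjoint \<P> \<and> \<P> \<subseteq> sets borel \<and> \<Union>\<P> = A}. \<Sum>B\<in>\<P>. ennreal \<bar>\<mu> B\<bar>)"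

definition variation_norm :: "('a::topological_space set \<Rightarrow> real) \<Rightarrow> real" where
  "variation_norm \<mu> = enn2real (variation \<mu> UNIV)"

definition regular_signed_measure :: "('a::topological_space set \<Rightarrow> real) \<Rightarrow> bool" where
  "regular_signed_measure \<mu> \<longleftrightarrow>
     (\<forall>A\<in>sets borel.
        variation \<mu> A = (INF U\<in>{U. open U \<and> A \<subseteq> U}. variation \<mu> U) \<and>
        variation \<mu> A = (SUP C\<in>{C. compact C \<and> C \<subseteq> A}. variation \<mu> C))"

text \<open>\<open>\<M>(K)\<close>, where \<open>K\<close> is the whole type.\<close>

definition signed_measures :: "('a::topological_space set \<Rightarrow> real) set" where
  "signed_measures = {\<mu>. signed_borel_measure \<mu> \<and> regular_signed_measure \<mu>}"

text \<open>
  Jordan decomposition \<open>\<mu>\<^sup>+ = (\<bar>\<mu>\<bar> + \<mu>) / 2\<close>, \<open>\<mu>\<^sup>- = (\<bar>\<mu>\<bar> - \<mu>) / 2\<close>, as library measures. The total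
  variation of a real-valued signed measure is finite, so passing through \<open>enn2real\<close> loses nothing.
\<close>

definition pos_variation :: "('a::topological_space set \<Rightarrow> real) \<Rightarrow> 'a measure" where
  "pos_variation \<mu> =
     measure_of UNIV (sets borel) (\<lambda>A. ennreal ((enn2real (variation \<mu> A) + \<mu> A) / 2))"

definition neg_variation :: "('a::topological_space set \<Rightarrow> real) \<Rightarrow> 'a measure" where
  "neg_variation \<mu> =
     measure_of UNIV (sets borel) (\<lambda>A. ennreal ((enn2real (variation \<mu> A) - \<mu> A) / 2))"

definition pairing :: "('a::topological_space set \<Rightarrow> real) \<Rightarrow> ('a \<Rightarrow>\<^sub>C real) \<Rightarrow> real" where
  "pairing \<mu> g =
     (\<integral>x. apply_bcontfun g x \<partial>pos_variation \<mu>) - (\<integral>x. apply_bcontfun g x \<partial>neg_variation \<mu>)"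

text \<open>
  The smallest closed set, with respect to inclusion, on whose complement \<open>\<bar>\<mu>\<bar>\<close> vanishes; it exists
  for every regular \<open>\<mu>\<close>.
\<close>

definition supp_measure :: "('a::topological_space set \<Rightarrow> real) \<Rightarrow> 'a set" where
  "supp_measure \<mu> = (LEAST S. closed S \<and> variation \<mu> (- S) = 0)"

definition signed_measures_on :: "'a::topological_space set \<Rightarrow> ('a set \<Rightarrow> real) set" where
  "signed_measures_on F = {\<mu> \<in> signed_measures. supp_measure \<mu> \<subseteq> F}"

definition unit_sphere_on :: "'a::topological_space set \<Rightarrow> ('a set \<Rightarrow> real) set" where
  "unit_sphere_on F = {\<mu> \<in> signed_measures_on F. variation_norm \<mu> = 1}"

definition prob_measures_on :: "'a::topological_space set \<Rightarrow> ('a set \<Rightarrow> real) set" where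
  "prob_measures_on F =
     {\<mu> \<in> signed_measures_on F. (\<forall>A\<in>sets borel. 0 \<le> \<mu> A) \<and> \<mu> UNIV = 1}"

text \<open>
  The coarsest topology on \<open>\<M>(K)\<close> making all maps \<open>\<mu> \<mapsto> \<langle>\<mu>, g\<rangle>\<close> continuous, i.e. pulled back from
  the product topology. On \<open>\<M>(F)\<close>, \<open>F\<close> closed in compact Hausdorff \<open>K\<close>, its subspace topology is
  the weak* topology of \<open>\<M>(F)\<close>, since continuous functions on \<open>F\<close> extend to \<open>K\<close>.
\<close>

definition weak_star_topology :: "('a::topological_space set \<Rightarrow> real) topology" where
  "weak_star_topology = pullback_topology signed_measures pairing (powertop_real UNIV)"

end

theory Submission
  imports Defs
begin

text \<open>
  Put \<open>S = T\<^sup>-\<^sup>1 \<circ> P\<close>, an operator of norm at most 1 from \<open>\<C>(K)\<close> to \<open>\<C>(L)\<close> with \<open>S \<circ> T = id\<close>. For \<open>x\<close>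
  in \<open>L\<close> the functional \<open>g \<mapsto> S g x\<close> is given by a regular signed measure \<open>\<phi> x\<close>, by the Riesz
  representation theorem; weak* continuity of \<open>\<phi>\<close> is just the continuity of every \<open>S g\<close>. The measure
  has norm 1, because its norm is at most 1 and \<open>\<langle>\<phi> x, T 1\<rangle> = S (T 1) x = 1\<close>.

  The key point is where \<open>\<phi> x\<close> lives. If \<open>\<parallel>f\<parallel> \<le> 1\<close> and \<open>f x = 1\<close>, then \<open>T f\<close> lies in the unit ball and
  \<open>\<langle>\<phi> x, T f\<rangle> = 1 = \<parallel>\<phi> x\<parallel>\<close>. A function of norm at most 1 at which a measure attains its norm has absolute
  value 1 on the whole support (\<open>variation_null_of_norming\<close>), so \<open>\<bar>T f y\<bar> = 1\<close> for all such \<open>f\<close> as soon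
  as \<open>y\<close> lies in the support of \<open>\<phi> x\<close>. Averaging two such functions shows that they all have the same
  image at \<open>y\<close>, and linearity then forces \<open>T f y = T 1 y * f x\<close> for every \<open>f\<close>
  (\<open>evaluation_of_extremal\<close>).

  Hence let \<open>F\<close> consist of all \<open>y\<close> with \<open>\<bar>T 1 y\<bar> = 1\<close> for which \<open>T f y = T 1 y * f x\<close> holds for some \<open>x\<close> and
  all \<open>f\<close>; put \<open>\<rho> y = x\<close> and \<open>\<sigma> y = T 1 y\<close>. The pairs \<open>(y, x)\<close> form a compact subset of
  \<open>K \<times> L\<close> on which the first coordinate is injective, which makes \<open>F\<close> closed and \<open>\<rho>\<close> continuous; \<open>\<rho>\<close> is
  onto because the support of \<open>\<phi> x\<close> is a nonempty part of \<open>\<rho>\<^sup>-\<^sup>1(x)\<close>. The formula for \<open>P g = T (S g)\<close> on \<open>F\<close>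
  is the formula for \<open>T\<close> applied to \<open>S g\<close>.

  The larger part of the text proves the Riesz representation theorem on a compact Hausdorff space.
  A positive functional gives an outer measure, as in Rudin's proof, whose restriction to the Borel
  sets represents it (\<open>riesz_integral\<close>). A bounded functional is the difference of its positive and
  negative parts; a Hahn set for the resulting difference of measures computes its variation, Jordan
  decomposition and support.
\<close>

section \<open>Functions on a compact Hausdorff space\<close>

lemma compact_separating_function:
  fixes S T :: "'a::t2_space set"
  assumes "compact (UNIV :: 'a set)" "closed S" "closed T" "S \<inter> T = {}"
  obtains h :: "'a \<Rightarrow> real" where "continuous_on UNIV h" "\<And>x. 0 \<le> h x" "\<And>x. h x \<le> 1"
    "\<And>x. x \<in> S \<Longrightarrow> h x = 0" "\<And>x. x \<in> T \<Longrightarrow> h x = 1"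
proof -
  have "normal_space (euclidean :: 'a topology)"
    using assms(1) by (intro compact_Hausdorff_or_regular_imp_normal_space)
      (auto simp: compact_space_def Hausdorff_space_def disjnt_def separation_t2 intro: hausdorff)
  then obtain f where "continuous_map euclidean (top_of_set {0..1::real}) f" "f ` S \<subseteq> {0}" "f ` T \<subseteq> {1}"
    using Urysohn_lemma[of euclidean S T 0 1] assms by (auto simp: disjnt_def)
  then show ?thesis
    by (intro that[of f]) (auto simp: continuous_map_in_subtopology image_subset_iff)
qed

lemma Bcontfun_apply:
  fixes f :: "'a::topological_space \<Rightarrow> real"
  assumes "compact (UNIV :: 'a set)" "continuous_on UNIV f"
  shows "apply_bcontfun (Bcontfun f) = f"
  using compact_imp_bounded[OF compact_continuous_image[OF assms(2,1)]] assms(2)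
  by (intro Bcontfun_inverse) (auto simp: bcontfun_def)

section \<open>The Riesz theorem for positive functionals\<close>

text \<open>
  Only nonnegative functions occur: the positive part of a bounded functional is naturally defined on
  that cone, and additivity and positivity there already imply monotonicity.
\<close>

locale positive_functional =
  fixes L :: "('a::t2_space \<Rightarrow> real) \<Rightarrow> real"
  assumes compact_UNIV: "compact (UNIV :: 'a set)"
    and add: "continuous_on UNIV f \<Longrightarrow> continuous_on UNIV g \<Longrightarrow> (\<And>x. 0 \<le> f x) \<Longrightarrow> (\<And>x. 0 \<le> g x) \<Longrightarrow>
        L (\<lambda>x. f x + g x) = L f + L g"
    and scale: "continuous_on UNIV f \<Longrightarrow> (\<And>x. 0 \<le> f x) \<Longrightarrow> 0 \<le> c \<Longrightarrow> L (\<lambda>x. c * f x) = c * L f"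
    and nonneg: "continuous_on UNIV f \<Longrightarrow> (\<And>x. 0 \<le> f x) \<Longrightarrow> 0 \<le> L f"

context positive_functional
begin

lemma mono:
  assumes "continuous_on UNIV f" "continuous_on UNIV g" "\<And>x. 0 \<le> f x" "\<And>x. f x \<le> g x"
  shows "L f \<le> L g"
proof -
  have "L (\<lambda>x. f x + (g x - f x)) = L f + L (\<lambda>x. g x - f x)"
    using assms by (intro add continuous_intros) auto
  moreover have "0 \<le> L (\<lambda>x. g x - f x)"
    using assms by (intro nonneg continuous_intros) auto
  ultimately show ?thesis by simp
qed

lemma zero: "L (\<lambda>x. 0) = 0"
  using scale[of "\<lambda>x. 0" 0] by simp

lemma sum:
  assumes "finite I" "\<And>i. i \<in> I \<Longrightarrow> continuous_on UNIV (f i)" "\<And>i x. i \<in> I \<Longrightarrow> 0 \<le> f i x"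
  shows "L (\<lambda>x. \<Sum>i\<in>I. f i x) = (\<Sum>i\<in>I. L (f i))"
  using assms
proof (induction I rule: finite_induct)
  case (insert i I)
  then show ?case
    by (simp add: add continuous_on_sum sum_nonneg)
qed (simp add: zero)

text \<open>
  Replacing \<open>f\<close> by \<open>max (f - e) 0\<close> moves the support into the compact set where \<open>f \<ge> e\<close>, at an
  arbitrarily small cost.
\<close>

lemma le_truncated:
  assumes "continuous_on UNIV f" "\<And>x. 0 \<le> f x" "0 \<le> e"
  shows "L f \<le> L (\<lambda>x. max (f x - e) 0) + e * L (\<lambda>x. 1)"
proof -
  have "L f \<le> L (\<lambda>x. max (f x - e) 0 + e * 1)"
    using assms by (intro mono continuous_intros) auto
  also have "\<dots> = L (\<lambda>x. max (f x - e) 0) + L (\<lambda>x. e * 1)"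
    using assms by (intro add continuous_intros) auto
  also have "L (\<lambda>x. e * 1) = e * L (\<lambda>x. 1)"
    using assms by (intro scale) auto
  finally show ?thesis .
qed

text \<open>
  The competitors for the mass of an open set \<open>U\<close> vanish off \<open>U\<close>, but their support need not be contained
  in \<open>U\<close>; truncation recovers that whenever it matters.
\<close>

definition subordinate :: "'a set \<Rightarrow> ('a \<Rightarrow> real) set" where
  "subordinate U = {f. continuous_on UNIV f \<and> (\<forall>x. 0 \<le> f x \<and> f x \<le> 1) \<and> (\<forall>x. x \<notin> U \<longrightarrow> f x = 0)}"

definition open_mass :: "'a set \<Rightarrow> ennreal" where
  "open_mass U = (SUP f\<in>subordinate U. ennreal (L f))"

definition outer :: "'a set \<Rightarrow> ennreal" where
  "outer A = (INF U\<in>{U. open U \<and> A \<subseteq> U}. open_mass U)"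

lemma subordinateD:
  assumes "f \<in> subordinate U"
  shows "continuous_on UNIV f" "0 \<le> f x" "f x \<le> 1" "x \<notin> U \<Longrightarrow> f x = 0"
  using assms by (auto simp: subordinate_def)

lemma truncated_subordinate:
  "f \<in> subordinate U \<Longrightarrow> 0 \<le> e \<Longrightarrow> (\<lambda>x. max (f x - e) 0) \<in> subordinate U"
  by (auto simp: subordinate_def intro!: continuous_intros) (smt (verit))

lemma open_mass_upper: "f \<in> subordinate U \<Longrightarrow> ennreal (L f) \<le> open_mass U"
  unfolding open_mass_def by (rule SUP_upper)

text \<open>
  An upper bound for the open mass can be tested on truncated functions only, by letting \<open>e\<close> tend to 0.
\<close>

lemma open_mass_least:
  assumes "\<And>f e. f \<in> subordinate U \<Longrightarrow> 0 < e \<Longrightarrow> ennreal (L (\<lambda>x. max (f x - e) 0)) \<le> c"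
  shows "open_mass U \<le> c"
  unfolding open_mass_def
proof (rule SUP_least)
  fix f assume f: "f \<in> subordinate U"
  note fD = subordinateD[OF f]
  have L1: "0 \<le> L (\<lambda>x. 1)" by (rule nonneg) auto
  show "ennreal (L f) \<le> c"
  proof (rule ennreal_le_epsilon)
    fix e :: real assume e: "0 < e"
    define d where "d = e / (L (\<lambda>x. 1) + 1)"
    have d: "0 < d" "d * L (\<lambda>x. 1) \<le> e"
      using e L1 by (auto simp: d_def field_simps)
    have n: "0 \<le> L (\<lambda>x. max (f x - d) 0)"
      using fD by (intro nonneg continuous_intros) auto
    have "L f \<le> L (\<lambda>x. max (f x - d) 0) + d * L (\<lambda>x. 1)"
      using fD d by (intro le_truncated) auto
    then have "L f \<le> L (\<lambda>x. max (f x - d) 0) + e"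
      using d by linarith
    then have "ennreal (L f) \<le> ennreal (L (\<lambda>x. max (f x - d) 0)) + ennreal e"
      using n e by (simp flip: ennreal_plus add: ennreal_leI)
    also have "\<dots> \<le> c + ennreal e"
      using assms[OF f d(1)] by (intro add_right_mono)
    finally show "ennreal (L f) \<le> c + ennreal e" .
  qed
qed

lemma open_mass_mono: "U \<subseteq> V \<Longrightarrow> open_mass U \<le> open_mass V"
  unfolding open_mass_def by (rule SUP_subset_mono) (auto simp: subordinate_def)

lemma open_mass_empty: "open_mass {} = 0"
proof -
  have "subordinate {} = {\<lambda>x. 0}" by (auto simp: subordinate_def)
  then show ?thesis by (simp add: open_mass_def zero)
qed

lemma open_mass_UNIV: "open_mass UNIV = ennreal (L (\<lambda>x. 1))"
proof (rule antisym)
  show "open_mass UNIV \<le> ennreal (L (\<lambda>x. 1))"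
    unfolding open_mass_def
    by (intro SUP_least ennreal_leI mono) (auto simp: subordinate_def)
  show "ennreal (L (\<lambda>x. 1)) \<le> open_mass UNIV"
    by (rule open_mass_upper) (auto simp: subordinate_def)
qed

text \<open>
  The set \<open>C\<close> where \<open>f \<ge> e\<close> is covered by \<open>U\<close> and \<open>V\<close>. A function \<open>h\<close> that is 0 off \<open>U\<close> and 1 on
  \<open>C - V\<close> is a partition of unity for this cover: it splits the truncated \<open>f\<close> into a part vanishing off
  \<open>U\<close> and a part vanishing off \<open>V\<close>.
\<close>

lemma open_mass_Un:
  assumes "open U" "open V"
  shows "open_mass (U \<union> V) \<le> open_mass U + open_mass V"
proof (rule open_mass_least)
  fix f and e :: real assume f: "f \<in> subordinate (U \<union> V)" and e: "0 < e"
  note fD = subordinateD[OF f]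
  define C where "C = {x. e \<le> f x}"
  have "closed C"
    unfolding C_def using fD by (intro closed_Collect_le) auto
  moreover have "C \<subseteq> U \<union> V"
    using fD(4) e by (force simp: C_def)
  ultimately obtain h where h: "continuous_on UNIV h" "\<And>x. 0 \<le> h x" "\<And>x. h x \<le> 1"
      "\<And>x. x \<in> - U \<Longrightarrow> h x = 0" "\<And>x. x \<in> C - V \<Longrightarrow> h x = (1::real)"
    using compact_separating_function[of "- U" "C - V"] compact_UNIV assms
    by (metis Compl_disjoint2 Diff_subset_conv closed_Compl closed_Diff disjoint_eq_subset_Compl double_complement inf_commute sup_commute)
  let ?f = "\<lambda>x. max (f x - e) 0"
  have t: "?f \<in> subordinate (U \<union> V)"
    using f e by (intro truncated_subordinate) auto
  note tD = subordinateD[OF t]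
  have 1: "(\<lambda>x. ?f x * h x) \<in> subordinate U"
    using h tD unfolding subordinate_def
    by (auto intro!: continuous_intros mult_le_one)
  have 2: "(\<lambda>x. ?f x * (1 - h x)) \<in> subordinate V"
  proof -
    have "?f x * (1 - h x) = 0" if "x \<notin> V" for x
      using that h(5)[of x] e by (cases "x \<in> C") (auto simp: C_def)
    then show ?thesis
      using h(1-3) tD unfolding subordinate_def
      by (auto intro!: continuous_intros mult_le_one)
  qed
  have "L ?f = L (\<lambda>x. ?f x * h x + ?f x * (1 - h x))"
    by (simp add: algebra_simps)
  also have "\<dots> = L (\<lambda>x. ?f x * h x) + L (\<lambda>x. ?f x * (1 - h x))"
    using subordinateD[OF 1] subordinateD[OF 2] by (intro add) auto
  finally have "ennreal (L ?f) = ennreal (L (\<lambda>x. ?f x * h x)) + ennreal (L (\<lambda>x. ?f x * (1 - h x)))"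
    using subordinateD[OF 1] subordinateD[OF 2] by (simp add: ennreal_plus nonneg)
  also have "\<dots> \<le> open_mass U + open_mass V"
    by (intro add_mono open_mass_upper 1 2)
  finally show "ennreal (L ?f) \<le> open_mass U + open_mass V" .
qed

lemma open_mass_finite_UN:
  assumes "finite I" "\<And>i. i \<in> I \<Longrightarrow> open (U i)"
  shows "open_mass (\<Union>i\<in>I. U i) \<le> (\<Sum>i\<in>I. open_mass (U i))"
  using assms
proof (induction I rule: finite_induct)
  case (insert i I)
  have "open_mass (\<Union>i\<in>insert i I. U i) \<le> open_mass (U i) + open_mass (\<Union>i\<in>I. U i)"
    using insert.prems by (auto intro!: open_mass_Un)
  also have "\<dots> \<le> open_mass (U i) + (\<Sum>i\<in>I. open_mass (U i))"
    using insert by (intro add_left_mono) auto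
  finally show ?case using insert by simp
qed (simp add: open_mass_empty)

text \<open>
  Compactness of the set where \<open>f \<ge> e\<close> reduces the countable union to a finite one.
\<close>

lemma open_mass_UN:
  fixes U :: "nat \<Rightarrow> 'a set"
  assumes "\<And>i. open (U i)"
  shows "open_mass (\<Union>i. U i) \<le> (\<Sum>i. open_mass (U i))"
proof (rule open_mass_least)
  fix f and e :: real assume f: "f \<in> subordinate (\<Union>i. U i)" and e: "0 < e"
  note fD = subordinateD[OF f]
  define C where "C = {x. e \<le> f x}"
  have "closed C"
    unfolding C_def using fD by (intro closed_Collect_le) auto
  then have "compact C"
    using compact_UNIV compact_Int_closed[of UNIV C] by simp
  moreover have "C \<subseteq> (\<Union>i. U i)"
    using fD(4) e by (force simp: C_def)
  ultimately obtain I where I: "finite I" "C \<subseteq> (\<Union>i\<in>I. U i)"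
    using compactE_image[of C UNIV U] assms by metis
  have "max (f x - e) 0 = 0" if "x \<notin> (\<Union>i\<in>I. U i)" for x
  proof -
    have "x \<notin> C" using that I(2) by blast
    then show ?thesis by (simp add: C_def)
  qed
  then have "(\<lambda>x. max (f x - e) 0) \<in> subordinate (\<Union>i\<in>I. U i)"
    using subordinateD[OF truncated_subordinate[OF f, of e]] e
    unfolding subordinate_def by simp
  then have "ennreal (L (\<lambda>x. max (f x - e) 0)) \<le> open_mass (\<Union>i\<in>I. U i)"
    by (rule open_mass_upper)
  also have "\<dots> \<le> (\<Sum>i\<in>I. open_mass (U i))"
    using I assms by (intro open_mass_finite_UN)
  also have "\<dots> \<le> (\<Sum>i. open_mass (U i))"
    using I by (intro sum_le_suminf) auto
  finally show "ennreal (L (\<lambda>x. max (f x - e) 0)) \<le> (\<Sum>i. open_mass (U i))" .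
qed

lemma outer_le: "open U \<Longrightarrow> A \<subseteq> U \<Longrightarrow> outer A \<le> open_mass U"
  unfolding outer_def by (rule INF_lower) auto

lemma outer_open: "open U \<Longrightarrow> outer U = open_mass U"
  by (intro antisym outer_le) (auto simp: outer_def intro!: INF_greatest open_mass_mono)

lemma outer_mono: "A \<subseteq> B \<Longrightarrow> outer A \<le> outer B"
  unfolding outer_def by (rule INF_superset_mono) auto

lemma outer_finite: "outer A < \<infinity>"
proof -
  have "outer A \<le> open_mass UNIV" by (rule outer_le) auto
  then show ?thesis by (simp add: open_mass_UNIV order.strict_trans1)
qed

lemma outer_close:
  assumes "0 < e"
  obtains U where "open U" "A \<subseteq> U" "open_mass U \<le> outer A + ennreal e"
proof -
  have "outer A < outer A + ennreal e"
    using outer_finite[of A] assms ennreal_add_left_cancel_less[of "outer A" 0 "ennreal e"]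
    by (auto simp: less_top)
  then obtain U where "open U" "A \<subseteq> U" "open_mass U < outer A + ennreal e"
    by (auto simp: INF_less_iff outer_def)
  then show ?thesis using that by (auto intro: less_imp_le)
qed

lemma outer_measure_space_outer: "outer_measure_space UNIV outer"
  unfolding outer_measure_space_def
proof (intro conjI)
  show "positive UNIV outer"
    by (simp add: positive_def outer_open open_mass_empty)
  show "increasing UNIV outer"
    by (auto simp: increasing_def intro: outer_mono)
  show "countably_subadditive UNIV outer"
    unfolding countably_subadditive_def
  proof (intro allI impI)
    fix A :: "nat \<Rightarrow> 'a set"
    show "outer (\<Union>i. A i) \<le> (\<Sum>i. outer (A i))"
    proof (rule ennreal_le_epsilon)
      fix e :: real assume e: "0 < e"
      have "\<exists>U. open U \<and> A i \<subseteq> U \<and> open_mass U \<le> outer (A i) + ennreal (e * (1/2) ^ Suc i)" for i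
        using outer_close[of "e * (1/2) ^ Suc i" "A i"] e by (metis mult_pos_pos zero_less_divide_1_iff zero_less_numeral zero_less_power)
      then obtain U where U: "\<And>i. open (U i)" "\<And>i. A i \<subseteq> U i"
          "\<And>i. open_mass (U i) \<le> outer (A i) + ennreal (e * (1/2) ^ Suc i)"
        by metis
      have "outer (\<Union>i. A i) \<le> open_mass (\<Union>i. U i)"
        using U by (intro outer_le) auto
      also have "\<dots> \<le> (\<Sum>i. open_mass (U i))"
        using U by (intro open_mass_UN)
      also have "\<dots> \<le> (\<Sum>i. outer (A i) + ennreal (e * (1/2) ^ Suc i))"
        using U by (intro suminf_le) auto
      also have "\<dots> = (\<Sum>i. outer (A i)) + (\<Sum>i. ennreal (e * (1/2) ^ Suc i))"
        by (intro suminf_add[symmetric]) auto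
      also have "(\<Sum>i. ennreal (e * (1/2) ^ Suc i)) = ennreal (\<Sum>i. e * (1/2) ^ Suc i)"
        using e power_half_series by (intro suminf_ennreal2) (auto intro!: summable_mult sums_summable)
      also have "(\<Sum>i. e * (1/2) ^ Suc i) = e"
        using sums_mult[OF power_half_series, of e] by (simp add: sums_iff)
      finally show "outer (\<Union>i. A i) \<le> (\<Sum>i. outer (A i)) + ennreal e" .
    qed
  qed
qed

text \<open>
  A truncated competitor for \<open>V \<inter> U\<close> lives on a closed set \<open>C \<subseteq> U\<close>. It can be added to any competitor
  for the open set \<open>V - C\<close>, which contains \<open>V - U\<close>, without exceeding 1. This is the
  Caratheodory condition for \<open>U\<close>, tested on open sets.
\<close>

lemma open_mass_split:
  assumes "open U" "open V"
  shows "open_mass (V \<inter> U) + outer (V - U) \<le> open_mass V"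
proof -
  have *: "ennreal (L f') + outer (V - U) \<le> open_mass V" 
    if f: "f \<in> subordinate (V \<inter> U)" and e: "0 < e" and f': "f' = (\<lambda>x. max (f x - e) 0)" for f f' e
  proof -
    define C where "C = {x. e \<le> f x}"
    have C: "closed C"
      unfolding C_def using subordinateD[OF f] by (intro closed_Collect_le) auto
    have CU: "C \<subseteq> U" using subordinateD(4)[OF f] e by (force simp: C_def)
    have f's: "f' \<in> subordinate (V \<inter> U)"
      unfolding f' using e f by (intro truncated_subordinate) auto
    note f'D = subordinateD[OF f's]
    have f'0: "f' x = 0" if "x \<notin> C" for x
      using that by (auto simp: C_def f')
    have "ennreal (L f') + open_mass (V - C) = (SUP g\<in>subordinate (V - C). ennreal (L f') + ennreal (L g))"
      unfolding open_mass_def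
      by (subst ennreal_SUP_add_right) (auto simp: subordinate_def intro!: exI[of _ "\<lambda>x. 0"])
    also have "\<dots> \<le> open_mass V"
    proof (rule SUP_least)
      fix g assume g: "g \<in> subordinate (V - C)"
      note gD = subordinateD[OF g]
      have "(\<lambda>x. f' x + g x) \<in> subordinate V"
        unfolding subordinate_def
      proof (intro CollectI conjI allI impI)
        show "continuous_on UNIV (\<lambda>x. f' x + g x)"
          using f'D gD by (intro continuous_intros)
        fix x
        show "0 \<le> f' x + g x" using f'D gD by simp
        show "f' x + g x \<le> 1"
          using f'0[of x] f'D(3)[of x] gD(3,4)[of x] by (cases "x \<in> C") auto
        show "f' x + g x = 0" if "x \<notin> V"
          using f'D(4)[of x] gD(4)[of x] that by auto
      qed
      then have "ennreal (L (\<lambda>x. f' x + g x)) \<le> open_mass V"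
        by (rule open_mass_upper)
      then show "ennreal (L f') + ennreal (L g) \<le> open_mass V"
        using f'D gD by (simp add: add ennreal_plus nonneg)
    qed
    finally have "ennreal (L f') + open_mass (V - C) \<le> open_mass V" .
    moreover have "outer (V - U) \<le> open_mass (V - C)"
      using assms C CU by (intro outer_le) (auto intro: open_Diff)
    ultimately show ?thesis
      by (meson add_left_mono order_trans)
  qed
  have "open_mass (V \<inter> U) \<le> open_mass V - outer (V - U)"
    using * outer_finite[of "V - U"]
    by (intro open_mass_least) (simp add: ennreal_le_minus_iff outer_finite add.commute)
  then show ?thesis
    using outer_mono[of "V - U" V] assms
    by (auto simp: ennreal_le_minus_iff outer_open add.commute)
qed

lemma open_in_lambda_system:
  assumes U: "open U"
  shows "U \<in> lambda_system UNIV UNIV outer"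
proof -
  have "outer (U \<inter> A) + outer ((UNIV - U) \<inter> A) = outer A" for A
  proof (rule antisym)
    show "outer (U \<inter> A) + outer ((UNIV - U) \<inter> A) \<le> outer A"
      unfolding outer_def[of A]
    proof (rule INF_greatest)
      fix V assume "V \<in> {V. open V \<and> A \<subseteq> V}"
      then have V: "open V" "A \<subseteq> V" by auto
      have "outer (U \<inter> A) + outer ((UNIV - U) \<inter> A) \<le> outer (V \<inter> U) + outer (V - U)"
        using V by (intro add_mono outer_mono) auto
      also have "\<dots> \<le> open_mass V"
        using open_mass_split[OF U V(1)] U V by (simp add: outer_open open_Int)
      finally show "outer (U \<inter> A) + outer ((UNIV - U) \<inter> A) \<le> open_mass V" .
    qed
    interpret sigma_algebra UNIV "UNIV :: 'a set set"
      using sigma_algebra_Pow[of "UNIV :: 'a set"] by simp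
    have "subadditive UNIV outer"
      using outer_measure_space_outer countably_subadditive_subadditive
      unfolding outer_measure_space_def by blast
    then have "outer ((U \<inter> A) \<union> ((UNIV - U) \<inter> A)) \<le> outer (U \<inter> A) + outer ((UNIV - U) \<inter> A)"
      by (intro subadditiveD) auto
    moreover have "(U \<inter> A) \<union> ((UNIV - U) \<inter> A) = A" by auto
    ultimately show "outer A \<le> outer (U \<inter> A) + outer ((UNIV - U) \<inter> A)" by simp
  qed
  then show ?thesis by (simp add: lambda_system_def)
qed

definition riesz_measure :: "'a measure" where
  "riesz_measure = measure_of UNIV (sets borel) outer"

lemma sets_riesz [simp, measurable_cong]: "sets riesz_measure = sets borel"
  by (simp add: riesz_measure_def sets.sigma_sets_eq[of borel, simplified])

lemma space_riesz [simp]: "space riesz_measure = UNIV"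
  by (simp add: riesz_measure_def)

lemma emeasure_riesz: 
  assumes "A \<in> sets borel"
  shows "emeasure riesz_measure A = outer A"
proof -
  interpret sigma_algebra UNIV "UNIV :: 'a set set"
    using sigma_algebra_Pow[of "UNIV :: 'a set"] by simp
  have ms: "measure_space UNIV (lambda_system UNIV UNIV outer) outer"
    by (rule caratheodory_lemma[OF outer_measure_space_outer])
  then have sa: "sigma_algebra UNIV (lambda_system UNIV UNIV outer)"
    by (simp add: measure_space_def)
  have "sets borel \<subseteq> lambda_system UNIV UNIV outer"
    using sigma_algebra.sigma_sets_subset[OF sa, of "{S. open S}"] open_in_lambda_system
    by (simp add: borel_def subset_iff)
  then have "measure_space UNIV (sets borel) outer"
    using ms by (rule measure_down[OF _ sets.sigma_algebra_axioms[of borel, simplified], rotated])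
  then show ?thesis
    unfolding riesz_measure_def using assms
    by (intro emeasure_measure_of_sigma) (auto simp: measure_space_def)
qed

lemma finite_riesz: "finite_measure riesz_measure"
  by (rule finite_measureI) (simp add: emeasure_riesz outer_open open_mass_UNIV)

lemma riesz_total: "measure riesz_measure UNIV = L (\<lambda>x. 1)"
  by (simp add: measure_def emeasure_riesz outer_open open_mass_UNIV nonneg)

lemma riesz_outer_regular:
  assumes A: "A \<in> sets borel" and e: "0 < e"
  obtains U where "open U" "A \<subseteq> U" "measure riesz_measure (U - A) < e"
proof -
  interpret finite_measure riesz_measure by (rule finite_riesz)
  obtain U where U: "open U" "A \<subseteq> U" "open_mass U \<le> outer A + ennreal (e/2)"
    using outer_close[of "e/2" A] half_gt_zero[OF e] by metis
  have "emeasure riesz_measure U \<le> emeasure riesz_measure A + ennreal (e/2)"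
    using U A by (simp add: emeasure_riesz outer_open)
  then have "measure riesz_measure U \<le> measure riesz_measure A + e/2"
    using e ennreal_plus[of "measure riesz_measure A" "e/2"]
    unfolding emeasure_eq_measure by (metis add_nonneg_nonneg ennreal_le_iff half_gt_zero_iff less_imp_le measure_nonneg)
  moreover have "measure riesz_measure (U - A) = measure riesz_measure U - measure riesz_measure A"
    using U(1,2) A by (intro finite_measure_Diff) auto
  ultimately have "measure riesz_measure (U - A) < e"
    using e by linarith
  with U(1,2) show ?thesis by (rule that)
qed

text \<open>
  Cut \<open>g\<close> into \<open>n\<close> horizontal layers \<open>l k\<close> of height \<open>1/n\<close>, and let \<open>U k\<close> be the set where \<open>g > k/n\<close>.
  Then \<open>n * l k\<close> is a competitor for \<open>U k\<close> and is 1 on \<open>U (k + 1)\<close>, so \<open>L (l k)\<close> is at most \<open>1/n\<close> times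
  the mass of \<open>U k\<close> while the integral of \<open>l k\<close> is at least \<open>1/n\<close> times the mass of \<open>U (k + 1)\<close>. The
  shift of the index by one costs at most \<open>1/n\<close> times the total mass.
\<close>

lemma le_riesz_integral_unit:
  assumes g: "continuous_on UNIV g" "\<And>x. 0 \<le> g x" "\<And>x. g x \<le> 1"
  shows "L g \<le> (\<integral>x. g x \<partial>riesz_measure)"
proof -
  interpret finite_measure riesz_measure by (rule finite_riesz)
  have int: "integrable riesz_measure f" if "continuous_on UNIV f" "\<And>x. 0 \<le> f x" "\<And>x. f x \<le> 1"
    for f :: "'a \<Rightarrow> real"
    using that borel_measurable_continuous_onI[OF that(1)]
    by (intro integrable_const_bound[of _ 1]) (auto simp: measurable_cong_sets[OF sets_riesz refl])
  have bound: "L g \<le> measure riesz_measure UNIV / n + (\<integral>x. g x \<partial>riesz_measure)" if n: "0 < n" for n :: nat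
  proof -
    define l where "l k x = min (max (g x - real k / n) 0) (1 / n)" for k x
    define U where "U k = {x. real k / n < g x}" for k
    have U: "open (U k)" for k
      unfolding U_def using g by (intro open_Collect_less continuous_intros) auto
    have l: "continuous_on UNIV (l k)" "0 \<le> l k x" "l k x \<le> 1" "l k x \<le> 1 / n" for k x
      unfolding l_def using g n by (auto intro!: continuous_intros simp: min_le_iff_disj)
    have step: "min a b + min (max (a - b) 0) c = min a (c + b)" if "0 < c" for a b c :: real
      using that by (auto simp: min_def max_def)
    have "(\<Sum>j<k. l j x) = min (g x) (real k / n)" for k x
    proof (induction k)
      case (Suc k)
      then show ?case using step[of "1 / n" "g x" "real k / n"] n by (simp add: l_def add_divide_distrib)
    qed (use g(2)[of x] in simp)
    from this[of _ n] have sum_l: "(\<Sum>j<n. l j x) = g x" for x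
      using g(3)[of x] n by simp
    have upper: "L (l k) \<le> measure riesz_measure (U k) / n" for k
    proof -
      have "(\<lambda>x. n * l k x) \<in> subordinate (U k)"
        using l n unfolding subordinate_def U_def
        by (auto intro!: continuous_intros simp: field_simps) (simp add: l_def field_simps)
      then have "ennreal (L (\<lambda>x. n * l k x)) \<le> emeasure riesz_measure (U k)"
        using U by (simp add: emeasure_riesz outer_open open_mass_upper)
      then have "L (\<lambda>x. n * l k x) \<le> measure riesz_measure (U k)"
        by (simp add: emeasure_eq_measure)
      then show ?thesis
        using l n by (simp add: scale field_simps)
    qed
    have lower: "measure riesz_measure (U (Suc k)) / n \<le> (\<integral>x. l k x \<partial>riesz_measure)" for k
    proof -
      have "(\<integral>x. indicator (U (Suc k)) x / n \<partial>riesz_measure) \<le> (\<integral>x. l k x \<partial>riesz_measure)"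
      proof (rule integral_mono[OF _ int[OF l(1-3)]])
        show "integrable riesz_measure (\<lambda>x. indicator (U (Suc k)) x / real n)"
          using U by (intro integrable_divide integrable_real_indicator) (auto simp: emeasure_eq_measure)
        show "indicator (U (Suc k)) x / real n \<le> l k x" for x
          using n by (auto simp: U_def l_def indicator_def add_divide_distrib)
      qed
      then show ?thesis using U by simp
    qed
    have "L g = (\<Sum>k<n. L (l k))"
      using sum[of "{..<n}" l] l sum_l by simp
    also have "\<dots> \<le> (\<Sum>k<n. measure riesz_measure (U k) / n)"
      by (intro sum_mono upper)
    also have "\<dots> \<le> (\<Sum>k<Suc n. measure riesz_measure (U k) / n)"
      by simp
    also have "\<dots> = measure riesz_measure (U 0) / n + (\<Sum>k<n. measure riesz_measure (U (Suc k)) / n)"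
      by (rule sum.lessThan_Suc_shift)
    also have "\<dots> \<le> measure riesz_measure UNIV / n + (\<Sum>k<n. \<integral>x. l k x \<partial>riesz_measure)"
      by (intro add_mono sum_mono lower divide_right_mono finite_measure_mono) auto
    also have "(\<Sum>k<n. \<integral>x. l k x \<partial>riesz_measure) = (\<integral>x. (\<Sum>k<n. l k x) \<partial>riesz_measure)"
      using l by (intro Bochner_Integration.integral_sum[symmetric] int)
    finally show ?thesis by (simp add: sum_l)
  qed
  have "(\<lambda>n. measure riesz_measure UNIV / real n + (\<integral>x. g x \<partial>riesz_measure)) \<longlonglongrightarrow> 0 + (\<integral>x. g x \<partial>riesz_measure)"
    by (intro tendsto_intros tendsto_divide_0[OF tendsto_const] filterlim_at_top_imp_at_infinity filterlim_real_sequentially)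
  then show ?thesis
    using bound by (intro LIMSEQ_le_const[of _ "\<integral>x. g x \<partial>riesz_measure"]) (auto intro!: exI[of _ 1])
qed

text \<open>
  For \<open>0 \<le> g \<le> 1\<close>, the inequalities for \<open>g\<close> and for \<open>1 - g\<close> together give equality, since \<open>L\<close> and
  the integral agree on the constant 1. Compactness bounds \<open>g\<close>, and scaling does the rest.
\<close>

theorem riesz_integral:
  assumes g: "continuous_on UNIV g" "\<And>x. 0 \<le> g x"
  shows "(\<integral>x. g x \<partial>riesz_measure) = L g"
proof -
  interpret finite_measure riesz_measure by (rule finite_riesz)
  have unit: "(\<integral>x. f x \<partial>riesz_measure) = L f"
    if f: "continuous_on UNIV f" "\<And>x. 0 \<le> f x" "\<And>x. f x \<le> 1" for f
  proof (rule antisym)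
    have int: "integrable riesz_measure f"
      using f borel_measurable_continuous_onI[OF f(1)]
      by (intro integrable_const_bound[of _ 1]) (auto simp: measurable_cong_sets[OF sets_riesz refl])
    have "L (\<lambda>x. 1 - f x) \<le> (\<integral>x. 1 - f x \<partial>riesz_measure)"
      using f by (intro le_riesz_integral_unit continuous_intros) auto
    also have "\<dots> = L (\<lambda>x. 1) - (\<integral>x. f x \<partial>riesz_measure)"
      using int by (simp add: riesz_total)
    finally have "L (\<lambda>x. 1 - f x) \<le> L (\<lambda>x. 1) - (\<integral>x. f x \<partial>riesz_measure)" .
    moreover have "L (\<lambda>x. f x + (1 - f x)) = L f + L (\<lambda>x. 1 - f x)"
      using f by (intro add continuous_intros) auto
    ultimately show "(\<integral>x. f x \<partial>riesz_measure) \<le> L f" by simp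
  qed (rule le_riesz_integral_unit[OF f])
  have "bounded (range g)"
    using compact_continuous_image[OF g(1) compact_UNIV] by (rule compact_imp_bounded)
  then obtain B where "0 < B" "\<forall>x. norm (g x) \<le> B"
    unfolding bounded_pos by auto
  then have B: "0 < B" "\<And>x. g x \<le> B"
    using g(2) by auto
  have "(\<integral>x. g x / B \<partial>riesz_measure) = L (\<lambda>x. (1/B) * g x)"
    using unit[of "\<lambda>x. g x / B"] g B by (simp add: continuous_intros)
  also have "\<dots> = L g / B"
    using scale[of g "1/B"] g B by simp
  finally show ?thesis using B by simp
qed

end

section \<open>Signed measures with a Hahn set\<close>

lemma signed_borel_measure_empty: "signed_borel_measure \<mu> \<Longrightarrow> \<mu> {} = 0"
proof -
  assume "signed_borel_measure \<mu>"
  then have "(\<lambda>n::nat. \<mu> {}) sums \<mu> (\<Union>n::nat. {})"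
    unfolding signed_borel_measure_def by (elim conjE allE[of _ "\<lambda>n. {}"]) (auto simp: disjoint_family_on_def)
  then show ?thesis
    by (auto simp: sums_iff summable_const_iff)
qed

lemma signed_borel_measure_Un:
  assumes \<mu>: "signed_borel_measure \<mu>" and A: "A \<in> sets borel" "B \<in> sets borel" "A \<inter> B = {}"
  shows "\<mu> (A \<union> B) = \<mu> A + \<mu> B"
proof -
  have "range (binaryset A B) \<subseteq> sets borel" "disjoint_family (binaryset A B)"
    using A by (auto simp: range_binaryset_eq disjoint_family_on_def binaryset_def)
  then have "(\<lambda>n. \<mu> (binaryset A B n)) sums \<mu> (\<Union>n. binaryset A B n)"
    using \<mu> unfolding signed_borel_measure_def by blast
  then show ?thesis
    using binaryset_sums[of \<mu> A B, OF signed_borel_measure_empty[OF \<mu>]]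
    by (simp add: UN_binaryset_eq sums_iff)
qed

lemma signed_borel_measure_Union:
  assumes \<mu>: "signed_borel_measure \<mu>" and "finite P" "P \<subseteq> sets borel" "disjoint P"
  shows "\<mu> (\<Union>P) = sum \<mu> P"
  using assms(2-)
proof (induction P rule: finite_induct)
  case (insert A P)
  have "\<mu> (A \<union> \<Union>P) = \<mu> A + \<mu> (\<Union>P)"
    using insert by (intro signed_borel_measure_Un[OF \<mu>] sets.finite_Union) (auto simp: disjoint_def)
  then show ?case using insert by (auto simp: disjoint_def)
qed (simp add: signed_borel_measure_empty[OF \<mu>])

text \<open>
  A Hahn set turns the suprema in the definition of the variation into values of \<open>\<mu>\<close>, so that
  countable additivity of the variation and of the Jordan parts is inherited from \<open>\<mu>\<close>.
\<close>

locale hahn_set =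
  fixes \<mu> :: "'a::t2_space set \<Rightarrow> real" and Y :: "'a set"
  assumes signed: "signed_borel_measure \<mu>"
    and Y [measurable]: "Y \<in> sets borel"
    and pos: "A \<in> sets borel \<Longrightarrow> A \<subseteq> Y \<Longrightarrow> 0 \<le> \<mu> A"
    and neg: "A \<in> sets borel \<Longrightarrow> A \<inter> Y = {} \<Longrightarrow> \<mu> A \<le> 0"
begin

lemma split: "A \<in> sets borel \<Longrightarrow> \<mu> A = \<mu> (A \<inter> Y) + \<mu> (A - Y)"
  using signed_borel_measure_Un[OF signed, of "A \<inter> Y" "A - Y"] Y
  by (simp add: Int_Diff_Un Int_Diff_disjoint)

lemma pos_Int: "A \<in> sets borel \<Longrightarrow> 0 \<le> \<mu> (A \<inter> Y)"
  by (rule pos) auto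

lemma neg_Diff: "A \<in> sets borel \<Longrightarrow> \<mu> (A - Y) \<le> 0"
  by (rule neg) auto

lemma variation_eq:
  assumes A: "A \<in> sets borel"
  shows "variation \<mu> A = ennreal (\<mu> (A \<inter> Y) - \<mu> (A - Y))"
proof (rule antisym)
  show "variation \<mu> A \<le> ennreal (\<mu> (A \<inter> Y) - \<mu> (A - Y))"
    unfolding variation_def
  proof (rule SUP_least, clarify)
    fix P :: "'a set set"
    assume P: "finite P" "disjoint P" "P \<subseteq> sets borel" "A = \<Union>P"
    have part: "\<mu> (\<Union>P \<inter> B) = (\<Sum>C\<in>P. \<mu> (C \<inter> B))" if B: "B \<in> sets borel" for B
    proof -
      have "\<Union>P \<inter> B = \<Union>((\<lambda>C. C \<inter> B) ` P)" by auto
      also have "\<mu> \<dots> = sum \<mu> ((\<lambda>C. C \<inter> B) ` P)"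
        using P B by (intro signed_borel_measure_Union[OF signed]) (auto simp: disjoint_def)
      also have "\<dots> = (\<Sum>C\<in>P. \<mu> (C \<inter> B))"
      proof (rule sum.reindex_nontrivial[OF P(1), unfolded o_def])
        fix C D assume "C \<in> P" "D \<in> P" "C \<noteq> D" "C \<inter> B = D \<inter> B"
        then have "C \<inter> B = {}" using P(2) by (auto simp: disjoint_def)
        then show "\<mu> (C \<inter> B) = 0" using signed_borel_measure_empty[OF signed] by simp
      qed
      finally show ?thesis .
    qed
    have "(\<Sum>B\<in>P. ennreal \<bar>\<mu> B\<bar>) = ennreal (\<Sum>B\<in>P. \<bar>\<mu> B\<bar>)"
      by (rule sum_ennreal) auto
    also have "(\<Sum>B\<in>P. \<bar>\<mu> B\<bar>) \<le> (\<Sum>B\<in>P. \<mu> (B \<inter> Y) - \<mu> (B - Y))"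
    proof (rule sum_mono)
      fix B assume "B \<in> P"
      then have B: "B \<in> sets borel" using P by auto
      show "\<bar>\<mu> B\<bar> \<le> \<mu> (B \<inter> Y) - \<mu> (B - Y)"
        using split[OF B] pos_Int[OF B] neg_Diff[OF B] by linarith
    qed
    also have "\<dots> = \<mu> (\<Union>P \<inter> Y) - \<mu> (\<Union>P - Y)"
      using part[OF Y] part[of "- Y"] Y by (simp add: sum_subtractf Diff_eq)
    finally show "(\<Sum>B\<in>P. ennreal \<bar>\<mu> B\<bar>) \<le> ennreal (\<mu> (\<Union>P \<inter> Y) - \<mu> (\<Union>P - Y))"
      by (simp add: ennreal_leI)
  qed
next
  let ?P = "{A \<inter> Y, A - Y}"
  have "ennreal (\<mu> (A \<inter> Y) - \<mu> (A - Y)) = (\<Sum>B\<in>?P. ennreal \<bar>\<mu> B\<bar>)"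
  proof (cases "A \<inter> Y = A - Y")
    case True
    then have "A \<inter> Y = {}" "A - Y = {}" by blast+
    then show ?thesis unfolding \<open>A \<inter> Y = {}\<close> \<open>A - Y = {}\<close>
      by (simp add: signed_borel_measure_empty[OF signed])
  next
    case False
    then show ?thesis
      using pos_Int[OF A] neg_Diff[OF A] by (simp flip: ennreal_plus)
  qed
  also have "\<dots> \<le> variation \<mu> A"
    unfolding variation_def using A Y
    by (intro SUP_upper) (auto simp: disjoint_def)
  finally show "ennreal (\<mu> (A \<inter> Y) - \<mu> (A - Y)) \<le> variation \<mu> A" .
qed

text \<open>
  Facts on the negative variation follow from those on the positive variation through this symmetry.
\<close>

lemma swap: "hahn_set (\<lambda>A. - \<mu> A) (- Y)"
proof
  show "signed_borel_measure (\<lambda>A. - \<mu> A)"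
    using signed unfolding signed_borel_measure_def by (auto intro: sums_minus)
qed (use Y pos neg in \<open>auto simp: disjoint_eq_subset_Compl[symmetric]\<close>)

lemma neg_variation_eq: "neg_variation \<mu> = pos_variation (\<lambda>A. - \<mu> A)"
  unfolding neg_variation_def pos_variation_def by (simp add: variation_def)

lemma sets_pos_variation [simp, measurable_cong]: "sets (pos_variation \<mu>) = sets borel"
  by (simp add: pos_variation_def sets.sigma_sets_eq[of borel, simplified])

lemma sets_neg_variation [simp, measurable_cong]: "sets (neg_variation \<mu>) = sets borel"
  by (simp add: neg_variation_def sets.sigma_sets_eq[of borel, simplified])

lemma space_pos_variation [simp]: "space (pos_variation \<mu>) = UNIV"
  by (simp add: pos_variation_def)

lemma space_neg_variation [simp]: "space (neg_variation \<mu>) = UNIV"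
  by (simp add: neg_variation_def)

lemma emeasure_pos_variation:
  assumes A: "A \<in> sets borel"
  shows "emeasure (pos_variation \<mu>) A = ennreal (\<mu> (A \<inter> Y))"
proof -
  have eq: "ennreal ((enn2real (variation \<mu> A) + \<mu> A) / 2) = ennreal (\<mu> (A \<inter> Y))"
    if A: "A \<in> sets borel" for A
    using split[OF A] pos_Int[OF A] neg_Diff[OF A] by (simp add: variation_eq[OF A])
  have "pos_variation \<mu> = measure_of UNIV (sets borel) (\<lambda>A. ennreal (\<mu> (A \<inter> Y)))"
    unfolding pos_variation_def
    by (rule measure_of_eq) (auto simp: sets.sigma_sets_eq[of borel, simplified] eq)
  also have "emeasure \<dots> A = ennreal (\<mu> (A \<inter> Y))"
  proof (rule emeasure_measure_of_sigma[OF _ _ _ A])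
    show "sigma_algebra UNIV (sets (borel :: 'a measure))"
      using sets.sigma_algebra_axioms[of "borel :: 'a measure"] by simp
    show "positive (sets borel) (\<lambda>A. ennreal (\<mu> (A \<inter> Y)))"
      by (simp add: positive_def signed_borel_measure_empty[OF signed])
    show "countably_additive (sets borel) (\<lambda>A. ennreal (\<mu> (A \<inter> Y)))"
      unfolding countably_additive_def
    proof (intro allI impI)
      fix A :: "nat \<Rightarrow> 'a set"
      assume A: "range A \<subseteq> sets borel" "disjoint_family A"
      have "(\<lambda>i. \<mu> (A i \<inter> Y)) sums \<mu> (\<Union>i. A i \<inter> Y)"
        using A Y signed unfolding signed_borel_measure_def
        by (elim conjE allE[of _ "\<lambda>i. A i \<inter> Y"]) (auto simp: disjoint_family_on_def)
      then have "(\<lambda>i. \<mu> (A i \<inter> Y)) sums \<mu> ((\<Union>i. A i) \<inter> Y)" by simp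
      then show "(\<Sum>i. ennreal (\<mu> (A i \<inter> Y))) = ennreal (\<mu> ((\<Union>i. A i) \<inter> Y))"
        using A by (intro suminf_ennreal_eq pos_Int) auto
    qed
  qed
  finally show ?thesis .
qed

lemma emeasure_neg_variation:
  assumes A: "A \<in> sets borel"
  shows "emeasure (neg_variation \<mu>) A = ennreal (- \<mu> (A - Y))"
  using hahn_set.emeasure_pos_variation[OF swap A] by (simp add: neg_variation_eq Diff_eq)

lemma finite_pos_variation: "finite_measure (pos_variation \<mu>)"
  by (rule finite_measureI) (simp add: emeasure_pos_variation)

lemma finite_neg_variation: "finite_measure (neg_variation \<mu>)"
  by (rule finite_measureI) (simp add: emeasure_neg_variation)

lemma measure_pos_variation: "A \<in> sets borel \<Longrightarrow> measure (pos_variation \<mu>) A = \<mu> (A \<inter> Y)"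
  by (simp add: measure_def emeasure_pos_variation pos_Int)

lemma measure_neg_variation: "A \<in> sets borel \<Longrightarrow> measure (neg_variation \<mu>) A = - \<mu> (A - Y)"
  using neg_Diff[of A] by (simp add: measure_def emeasure_neg_variation)

lemma variation_eq_sum:
  assumes "A \<in> sets borel"
  shows "variation \<mu> A = emeasure (pos_variation \<mu>) A + emeasure (neg_variation \<mu>) A"
  using pos_Int[OF assms] neg_Diff[OF assms] ennreal_plus[of "\<mu> (A \<inter> Y)" "- \<mu> (A - Y)"]
  by (simp add: variation_eq[OF assms] emeasure_pos_variation[OF assms] emeasure_neg_variation[OF assms] del: ennreal_plus)

lemma variation_norm_eq_sum:
  "variation_norm \<mu> = measure (pos_variation \<mu>) UNIV + measure (neg_variation \<mu>) UNIV"
  using pos_Int[of UNIV] neg_Diff[of UNIV]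
  by (simp add: variation_norm_def variation_eq measure_pos_variation measure_neg_variation)

lemma variation_mono: 
  assumes "A \<subseteq> B" "A \<in> sets borel" "B \<in> sets borel"
  shows "variation \<mu> A \<le> variation \<mu> B"
  using assms by (simp add: variation_eq_sum add_mono emeasure_mono)

lemma integrable_bcontfun:
  fixes g :: "'a \<Rightarrow>\<^sub>C real"
  shows "integrable (pos_variation \<mu>) g" "integrable (neg_variation \<mu>) g"
proof -
  interpret p: finite_measure "pos_variation \<mu>" by (rule finite_pos_variation)
  interpret n: finite_measure "neg_variation \<mu>" by (rule finite_neg_variation)
  have m: "apply_bcontfun g \<in> borel_measurable borel"
    by (intro borel_measurable_continuous_onI) simp
  show "integrable (pos_variation \<mu>) g" 
    using m norm_bounded[of g] by (intro p.integrable_const_bound[of _ "norm g"]) auto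
  show "integrable (neg_variation \<mu>) g"
    using m norm_bounded[of g] by (intro n.integrable_const_bound[of _ "norm g"]) auto
qed

text \<open>
  The defect in the inequality \<open>\<langle>\<mu>, h\<rangle> \<le> \<parallel>\<mu>\<parallel>\<close>: for \<open>\<bar>h\<bar> \<le> 1\<close> both integrands are nonnegative.
\<close>

lemma variation_norm_gap:
  fixes h :: "'a \<Rightarrow>\<^sub>C real"
  shows "variation_norm \<mu> - pairing \<mu> h =
    (\<integral>x. 1 - h x \<partial>pos_variation \<mu>) + (\<integral>x. 1 + h x \<partial>neg_variation \<mu>)"
proof -
  interpret p: finite_measure "pos_variation \<mu>" by (rule finite_pos_variation)
  interpret n: finite_measure "neg_variation \<mu>" by (rule finite_neg_variation)
  show ?thesis
    using integrable_bcontfun[of h] by (simp add: variation_norm_eq_sum pairing_def)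
qed

lemma pairing_le_variation_norm:
  fixes h :: "'a \<Rightarrow>\<^sub>C real"
  assumes "norm h \<le> 1"
  shows "pairing \<mu> h \<le> variation_norm \<mu>"
proof -
  have "\<bar>h x\<bar> \<le> 1" for x using norm_bounded[of h x] assms by simp
  then have "0 \<le> 1 - h x" "0 \<le> 1 + h x" for x by (auto simp: abs_le_iff) (smt (verit))+
  then have "0 \<le> (\<integral>x. 1 - h x \<partial>pos_variation \<mu>)" "0 \<le> (\<integral>x. 1 + h x \<partial>neg_variation \<mu>)"
    by (auto intro: Bochner_Integration.integral_nonneg)
  then show ?thesis using variation_norm_gap[of h] by linarith
qed

text \<open>
  The defect vanishes, so \<open>h = 1\<close> almost everywhere for the positive variation and \<open>h = -1\<close> almost
  everywhere for the negative one.
\<close>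

lemma variation_null_of_norming:
  fixes h :: "'a \<Rightarrow>\<^sub>C real"
  assumes h: "norm h \<le> 1" and norming: "pairing \<mu> h = variation_norm \<mu>"
  shows "variation \<mu> {x. \<bar>h x\<bar> < 1} = 0"
proof -
  interpret p: finite_measure "pos_variation \<mu>" by (rule finite_pos_variation)
  interpret n: finite_measure "neg_variation \<mu>" by (rule finite_neg_variation)
  have "\<bar>h x\<bar> \<le> 1" for x using norm_bounded[of h x] h by simp
  then have le: "0 \<le> 1 - h x" "0 \<le> 1 + h x" for x by (auto simp: abs_le_iff) (smt (verit))+
  have "(\<integral>x. 1 - h x \<partial>pos_variation \<mu>) + (\<integral>x. 1 + h x \<partial>neg_variation \<mu>) = 0"
    using variation_norm_gap[of h] norming by simp
  moreover have "0 \<le> (\<integral>x. 1 - h x \<partial>pos_variation \<mu>)" "0 \<le> (\<integral>x. 1 + h x \<partial>neg_variation \<mu>)"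
    using le by (auto intro: Bochner_Integration.integral_nonneg)
  ultimately have "(\<integral>x. 1 - h x \<partial>pos_variation \<mu>) = 0" "(\<integral>x. 1 + h x \<partial>neg_variation \<mu>) = 0"
    by linarith+
  moreover have "integrable (pos_variation \<mu>) (\<lambda>x. 1 - h x)" "integrable (neg_variation \<mu>) (\<lambda>x. 1 + h x)"
    using integrable_bcontfun[of h] by simp_all
  ultimately have "AE x in pos_variation \<mu>. 1 - h x = 0" "AE x in neg_variation \<mu>. 1 + h x = 0"
    using le integral_nonneg_eq_0_iff_AE[of "pos_variation \<mu>" "\<lambda>x. 1 - h x"]
      integral_nonneg_eq_0_iff_AE[of "neg_variation \<mu>" "\<lambda>x. 1 + h x"] by auto
  then have AE: "AE x in pos_variation \<mu>. \<not> \<bar>h x\<bar> < 1" "AE x in neg_variation \<mu>. \<not> \<bar>h x\<bar> < 1"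
    by (auto elim!: eventually_mono)
  have O: "{x. \<bar>h x\<bar> < 1} \<in> sets borel"
    by (intro borel_open open_Collect_less continuous_intros) auto
  have "emeasure (pos_variation \<mu>) {x. \<bar>h x\<bar> < 1} = 0" 
    using AE(1) O AE_iff_measurable[of "{x. \<bar>h x\<bar> < 1}" "pos_variation \<mu>"] by simp
  moreover have "emeasure (neg_variation \<mu>) {x. \<bar>h x\<bar> < 1} = 0" 
    using AE(2) O AE_iff_measurable[of "{x. \<bar>h x\<bar> < 1}" "neg_variation \<mu>"] by simp
  ultimately show ?thesis using O by (simp add: variation_eq_sum)
qed

text \<open>
  The union of all open null sets is null by inner regularity, since a compact subset of it is covered by
  finitely many of them. So the least closed set in the definition of the support exists.
\<close>

lemma supp_measure_properties:
  assumes reg: "regular_signed_measure \<mu>"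
  shows "closed (supp_measure \<mu>)" "variation \<mu> (- supp_measure \<mu>) = 0"
    "closed S \<Longrightarrow> variation \<mu> (- S) = 0 \<Longrightarrow> supp_measure \<mu> \<subseteq> S"
proof -
  define N where "N = {U. open U \<and> variation \<mu> U = 0}"
  have oN: "open (\<Union>N)" by (auto simp: N_def)
  have null: "variation \<mu> (\<Union>N) = 0"
  proof -
    have compact_null: "variation \<mu> C = 0" if C: "compact C" "C \<subseteq> \<Union>N" for C
    proof -
      obtain D where D: "D \<subseteq> N" "finite D" "C \<subseteq> \<Union>D"
        using compactE[OF C] by (auto simp: N_def)
      have null_D: "emeasure (pos_variation \<mu>) U = 0 \<and> emeasure (neg_variation \<mu>) U = 0" if "U \<in> D" for U
        using that D(1) variation_eq_sum[of U] by (auto simp: N_def)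
      have sets: "U \<in> sets borel" if "U \<in> D" for U using that D(1) by (auto simp: N_def)
      have "emeasure (pos_variation \<mu>) (\<Union>D) = 0" "emeasure (neg_variation \<mu>) (\<Union>D) = 0"
        using emeasure_subadditive_finite[OF D(2), of id "pos_variation \<mu>"]
          emeasure_subadditive_finite[OF D(2), of id "neg_variation \<mu>"] sets null_D
        by auto
      then have "variation \<mu> (\<Union>D) = 0"
        using sets D(2) by (subst variation_eq_sum) auto
      moreover have "variation \<mu> C \<le> variation \<mu> (\<Union>D)"
        using C D sets by (intro variation_mono) (auto simp: borel_compact)
      ultimately show ?thesis by simp
    qed
    have "variation \<mu> (\<Union>N) = (SUP C\<in>{C. compact C \<and> C \<subseteq> \<Union>N}. variation \<mu> C)"
      using reg[unfolded regular_signed_measure_def, THEN bspec, OF borel_open[OF oN]] by (rule conjunct2)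
    also have "\<dots> \<le> 0"
      by (rule SUP_least) (use compact_null in auto)
    finally show ?thesis by simp
  qed
  have least: "- \<Union>N \<subseteq> S" if "closed S" "variation \<mu> (- S) = 0" for S
    using that by (auto simp: N_def)
  have eq: "supp_measure \<mu> = - \<Union>N"
    unfolding supp_measure_def using oN null least
    by (intro Least_equality) auto
  show "closed (supp_measure \<mu>)" "variation \<mu> (- supp_measure \<mu>) = 0"
    "closed S \<Longrightarrow> variation \<mu> (- S) = 0 \<Longrightarrow> supp_measure \<mu> \<subseteq> S"
    using oN null least by (auto simp: eq)
qed

end

section \<open>Differences of finite measures\<close>

text \<open>
  Jordan parts are compared with a given decomposition through the identity \<open>M + \<mu>\<^sup>- = N + \<mu>\<^sup>+\<close>; the
  identity has to be integrated.
\<close>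

lemma integral_add_eq:
  fixes g :: "'a \<Rightarrow> real"
  assumes fin: "finite_measure M" "finite_measure N" "finite_measure M'" "finite_measure N'"
    and sets: "sets M = sets S" "sets N = sets S" "sets M' = sets S" "sets N' = sets S"
    and eq: "\<And>A. A \<in> sets S \<Longrightarrow> measure M A + measure N A = measure M' A + measure N' A"
    and g: "g \<in> borel_measurable S" "\<And>x. \<bar>g x\<bar> \<le> B"
  shows "(\<integral>x. g x \<partial>M) + (\<integral>x. g x \<partial>N) = (\<integral>x. g x \<partial>M') + (\<integral>x. g x \<partial>N')"
proof -
  have ms: "f \<in> borel_measurable M" "f \<in> borel_measurable N" "f \<in> borel_measurable M'" "f \<in> borel_measurable N'"
    if "f \<in> borel_measurable S" for f :: "'a \<Rightarrow> ennreal"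
    using that sets by (simp_all cong: measurable_cong_sets)
  have nn: "(\<integral>\<^sup>+x. f x \<partial>M) + (\<integral>\<^sup>+x. f x \<partial>N) = (\<integral>\<^sup>+x. f x \<partial>M') + (\<integral>\<^sup>+x. f x \<partial>N')"
    if "f \<in> borel_measurable S" for f
    using that
  proof (induction rule: borel_measurable_induct)
    case (cong f g)
    have sp: "space M = space S" "space N = space S" "space M' = space S" "space N' = space S"
      using sets[THEN sets_eq_imp_space_eq] by simp_all
    have "(\<integral>\<^sup>+x. f x \<partial>K) = (\<integral>\<^sup>+x. g x \<partial>K)" if "space K = space S" for K
      using cong that by (intro nn_integral_cong) auto
    then show ?case using cong sp by simp
  next
    case (set A)
    then show ?case
      using eq[OF set] sets fin
      by (simp add: finite_measure.emeasure_eq_measure flip: ennreal_plus)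
  next
    case (mult u c)
    then show ?case by (simp add: ms nn_integral_cmult flip: distrib_left)
  next
    case (add u v)
    then show ?case by (simp add: ms nn_integral_add) (metis (no_types, lifting) add.assoc add.commute)
  next
    case (seq U)
    have "(\<integral>\<^sup>+x. (SUP i. U i x) \<partial>K) + (\<integral>\<^sup>+x. (SUP i. U i x) \<partial>K') = (SUP i. (\<integral>\<^sup>+x. U i x \<partial>K) + (\<integral>\<^sup>+x. U i x \<partial>K'))"
      if "sets K = sets S" "sets K' = sets S" for K K'
    proof -
      have "U i \<in> borel_measurable K" "U i \<in> borel_measurable K'" for i
        using seq(1)[of i] that by (simp_all cong: measurable_cong_sets)
      then show ?thesis
        using seq(3)
        by (simp add: nn_integral_monotone_convergence_SUP ennreal_SUP_add incseq_nn_integral)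
    qed
    then show ?case using seq sets by (simp add: SUP_apply[abs_def] image_image)
  qed
  have int: "integrable K f" if "finite_measure K" "sets K = sets S" "f \<in> borel_measurable S" "\<And>x. \<bar>f x\<bar> \<le> b"
    for K b and f :: "'a \<Rightarrow> real"
  proof -
    have "f \<in> borel_measurable K"
      using that(3) measurable_cong_sets[OF that(2) refl, of "borel :: real measure"] by simp
    then show ?thesis
      using that(4) by (intro finite_measure.integrable_const_bound[OF that(1), of _ b]) auto
  qed
  have pos: "(\<integral>x. f x \<partial>M) + (\<integral>x. f x \<partial>N) = (\<integral>x. f x \<partial>M') + (\<integral>x. f x \<partial>N')"
    if f: "f \<in> borel_measurable S" "\<And>x. \<bar>f x\<bar> \<le> b" "\<And>x. 0 \<le> f x"
    for f :: "'a \<Rightarrow> real" and b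
  proof -
    have e: "(\<integral>\<^sup>+x. ennreal (f x) \<partial>K) = ennreal (\<integral>x. f x \<partial>K)" if "finite_measure K" "sets K = sets S" for K
      using int[OF that f(1,2)] f(3) by (intro nn_integral_eq_integral) auto
    show ?thesis
      using nn[of "\<lambda>x. ennreal (f x)"] f(1,3) fin sets
      by (simp add: e Bochner_Integration.integral_nonneg flip: ennreal_plus)
  qed
  have B: "0 \<le> B" using g(2) by (meson abs_ge_zero order_trans)
  have l: "0 \<le> g x + B" for x using g(2)[of x] by linarith
  have shift: "(\<integral>x. g x + B \<partial>K) = (\<integral>x. g x \<partial>K) + B * measure K (space S)" if "finite_measure K" "sets K = sets S" for K
    using int[OF that g] that sets_eq_imp_space_eq[OF that(2)]
    by (subst Bochner_Integration.integral_add) (auto simp: finite_measure.integrable_const)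
  have u: "\<bar>g x + B\<bar> \<le> 2 * B" for x using g(2)[of x] l[of x] by linarith
  have "(\<integral>x. g x + B \<partial>M) + (\<integral>x. g x + B \<partial>N) = (\<integral>x. g x + B \<partial>M') + (\<integral>x. g x + B \<partial>N')"
    by (rule pos[OF _ u l]) (use g in auto)
  moreover have "B * measure M (space S) + B * measure N (space S) = B * measure M' (space S) + B * measure N' (space S)"
    using eq[OF sets.top[of S]] by (simp flip: distrib_left)
  ultimately show ?thesis
    using fin sets by (simp add: shift)
qed

definition measure_difference :: "'a::t2_space measure \<Rightarrow> 'a measure \<Rightarrow> 'a set \<Rightarrow> real" where
  "measure_difference M N A = (if A \<in> sets borel then measure M A - measure N A else 0)"

lemma hahn_set_measure_difference:
  fixes M N :: "'a::t2_space measure"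
  assumes fin: "finite_measure M" "finite_measure N" and [simp]: "sets M = sets borel" "sets N = sets borel"
  obtains Y where "hahn_set (measure_difference M N) Y"
proof -
  interpret M: finite_measure M by fact
  interpret N: finite_measure N by fact
  obtain Y where Y: "Y \<in> sets M" "\<forall>X\<in>sets M. X \<subseteq> Y \<longrightarrow> N X \<le> M X" "\<forall>X\<in>sets M. X \<inter> Y = {} \<longrightarrow> M X \<le> N X"
    using finite_unsigned_Hahn_decomposition[OF fin] by auto
  have "hahn_set (measure_difference M N) Y"
  proof
    show "signed_borel_measure (measure_difference M N)"
      unfolding signed_borel_measure_def
    proof (intro conjI allI impI)
      fix A :: "nat \<Rightarrow> 'a set" assume A: "range A \<subseteq> sets borel" "disjoint_family A"
      then have "(\<lambda>n. measure M (A n) - measure N (A n)) sums (measure M (\<Union>n. A n) - measure N (\<Union>n. A n))"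
        by (intro sums_diff M.finite_measure_UNION N.finite_measure_UNION) auto
      then show "(\<lambda>n. measure_difference M N (A n)) sums measure_difference M N (\<Union>n. A n)"
        using A by (simp add: measure_difference_def range_subsetD sets.countable_UN)
    qed (simp add: measure_difference_def)
  qed (use Y in \<open>auto simp: measure_difference_def M.emeasure_eq_measure N.emeasure_eq_measure\<close>)
  then show ?thesis by (rule that)
qed

lemma pairing_measure_difference:
  fixes M N :: "'a::t2_space measure"
  assumes fin: "finite_measure M" "finite_measure N" and [simp]: "sets M = sets borel" "sets N = sets borel"
  shows "pairing (measure_difference M N) g = (\<integral>x. g x \<partial>M) - (\<integral>x. g x \<partial>N)"
proof -
  obtain Y where "hahn_set (measure_difference M N) Y"
    using hahn_set_measure_difference[OF assms] by metis
  then interpret hahn_set "measure_difference M N" Y .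
  have "(\<integral>x. g x \<partial>M) + (\<integral>x. g x \<partial>neg_variation (measure_difference M N)) =
    (\<integral>x. g x \<partial>N) + (\<integral>x. g x \<partial>pos_variation (measure_difference M N))"
  proof (rule integral_add_eq[where S = borel and B = "norm g"])
    fix A :: "'a set" assume A: "A \<in> sets borel"
    show "measure M A + measure (neg_variation (measure_difference M N)) A =
      measure N A + measure (pos_variation (measure_difference M N)) A"
      using A split[OF A] by (simp add: measure_pos_variation measure_neg_variation) (simp add: measure_difference_def)
  next
    show "apply_bcontfun g \<in> borel_measurable borel"
      by (intro borel_measurable_continuous_onI) simp
  next
    show "\<bar>g x\<bar> \<le> norm g" for x using norm_bounded[of g x] by simp
  qed (use fin finite_neg_variation finite_pos_variation in auto)
  then show ?thesis by (simp add: pairing_def)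
qed

lemma variation_measure_difference_le:
  fixes M N :: "'a::t2_space measure"
  assumes fin: "finite_measure M" "finite_measure N" and [simp]: "sets M = sets borel" "sets N = sets borel"
    and A: "A \<in> sets borel"
  shows "variation (measure_difference M N) A \<le> ennreal (measure M A + measure N A)"
proof -
  obtain Y where "hahn_set (measure_difference M N) Y"
    using hahn_set_measure_difference[OF fin] by auto
  then interpret hahn_set "measure_difference M N" Y .
  interpret M: finite_measure M by fact
  interpret N: finite_measure N by fact
  have [measurable]: "Y \<in> sets borel" by (rule Y)
  have "measure M (A \<inter> Y) \<le> measure M A" "measure N (A - Y) \<le> measure N A"
    using A by (auto intro!: M.finite_measure_mono N.finite_measure_mono)
  moreover have "0 \<le> measure N (A \<inter> Y)" "0 \<le> measure M (A - Y)" by auto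
  moreover have "measure_difference M N (A \<inter> Y) = measure M (A \<inter> Y) - measure N (A \<inter> Y)"
    "measure_difference M N (A - Y) = measure M (A - Y) - measure N (A - Y)"
    using A by (auto simp: measure_difference_def)
  ultimately show ?thesis
    unfolding variation_eq[OF A] by (intro ennreal_leI) linarith
qed

definition outer_regular :: "'a::topological_space measure \<Rightarrow> bool" where
  "outer_regular M \<longleftrightarrow> (\<forall>A\<in>sets borel. \<forall>e>0. \<exists>U. open U \<and> A \<subseteq> U \<and> measure M (U - A) < e)"

text \<open>
  The variation is dominated by \<open>M + N\<close>, so it inherits outer regularity. Inner regularity is outer
  regularity of the complement, closed sets being compact here.
\<close>

lemma regular_measure_difference:
  fixes M N :: "'a::t2_space measure"
  assumes fin: "finite_measure M" "finite_measure N" and sets [simp]: "sets M = sets borel" "sets N = sets borel"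
    and K: "compact (UNIV :: 'a set)" and reg: "outer_regular M" "outer_regular N"
  shows "regular_signed_measure (measure_difference M N)"
proof -
  let ?v = "variation (measure_difference M N)"
  obtain Y where "hahn_set (measure_difference M N) Y"
    using hahn_set_measure_difference[OF fin sets] by metis
  then interpret hahn_set "measure_difference M N" Y .
  interpret M: finite_measure M by fact
  interpret N: finite_measure N by fact
  have close: "\<exists>U. open U \<and> A \<subseteq> U \<and> ?v (U - A) \<le> ennreal e" if A: "A \<in> sets borel" and e: "0 < e" for A e
  proof -
    obtain U1 where U1: "open U1" "A \<subseteq> U1" "measure M (U1 - A) < e / 2"
      using reg(1) A half_gt_zero[OF e] unfolding outer_regular_def by meson
    obtain U2 where U2: "open U2" "A \<subseteq> U2" "measure N (U2 - A) < e / 2"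
      using reg(2) A half_gt_zero[OF e] unfolding outer_regular_def by meson
    have "?v (U1 \<inter> U2 - A) \<le> ennreal (measure M (U1 \<inter> U2 - A) + measure N (U1 \<inter> U2 - A))"
      using A U1 U2 by (intro variation_measure_difference_le fin) auto
    also have "\<dots> \<le> ennreal e"
    proof (rule ennreal_leI)
      have "measure M (U1 \<inter> U2 - A) \<le> measure M (U1 - A)" "measure N (U1 \<inter> U2 - A) \<le> measure N (U2 - A)"
        using A U1 U2 by (auto intro!: M.finite_measure_mono N.finite_measure_mono)
      then show "measure M (U1 \<inter> U2 - A) + measure N (U1 \<inter> U2 - A) \<le> e"
        using U1 U2 by linarith
    qed
    finally show ?thesis using U1 U2 by (intro exI[of _ "U1 \<inter> U2"]) auto
  qed
  have additive: "?v B = ?v A + ?v (B - A)" if AB: "A \<subseteq> B" "A \<in> sets borel" "B \<in> sets borel" for A B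
  proof -
    have "emeasure K A + emeasure K (B - A) = emeasure K B" if "sets K = sets borel" for K
      using AB that by (subst plus_emeasure) (auto simp: Un_absorb1)
    from this[of "pos_variation (measure_difference M N)"] this[of "neg_variation (measure_difference M N)"]
    have "emeasure (pos_variation (measure_difference M N)) B =
        emeasure (pos_variation (measure_difference M N)) A + emeasure (pos_variation (measure_difference M N)) (B - A)"
      "emeasure (neg_variation (measure_difference M N)) B =
        emeasure (neg_variation (measure_difference M N)) A + emeasure (neg_variation (measure_difference M N)) (B - A)"
      by simp_all
    then show ?thesis
      using AB variation_eq_sum[of A] variation_eq_sum[of B] variation_eq_sum[of "B - A"] 
      by (simp add: ac_simps)
  qed
  show ?thesis
    unfolding regular_signed_measure_def
  proof (intro ballI conjI)
    fix A :: "'a set" assume A: "A \<in> sets borel"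
    show "?v A = (INF U\<in>{U. open U \<and> A \<subseteq> U}. ?v U)"
    proof (rule antisym)
      show "?v A \<le> (INF U\<in>{U. open U \<and> A \<subseteq> U}. ?v U)"
        using A by (intro INF_greatest variation_mono) auto
      show "(INF U\<in>{U. open U \<and> A \<subseteq> U}. ?v U) \<le> ?v A"
      proof (rule ennreal_le_epsilon)
        fix e :: real assume "0 < e"
        then obtain U where U: "open U" "A \<subseteq> U" "?v (U - A) \<le> ennreal e"
          using close[OF A] by blast
        have "(INF U\<in>{U. open U \<and> A \<subseteq> U}. ?v U) \<le> ?v U"
          using U by (intro INF_lower) auto
        also have "\<dots> \<le> ?v A + ennreal e"
          using U A additive[of A U] by (simp add: add_left_mono)
        finally show "(INF U\<in>{U. open U \<and> A \<subseteq> U}. ?v U) \<le> ?v A + ennreal e" .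
      qed
    qed
    show "?v A = (SUP C\<in>{C. compact C \<and> C \<subseteq> A}. ?v C)"
    proof (rule antisym)
      show "(SUP C\<in>{C. compact C \<and> C \<subseteq> A}. ?v C) \<le> ?v A"
        using A by (intro SUP_least variation_mono) (auto simp: borel_compact)
      show "?v A \<le> (SUP C\<in>{C. compact C \<and> C \<subseteq> A}. ?v C)"
      proof (rule ennreal_le_epsilon)
        fix e :: real assume e: "0 < e"
        have "- A \<in> sets borel" using A by auto
        then obtain U where U: "open U" "- A \<subseteq> U" "?v (U - - A) \<le> ennreal e"
          using close[OF _ e] by metis
        have "compact (- U)"
          using compact_Int_closed[OF K, of "- U"] U(1) by (simp add: closed_Compl)
        then have "?v (- U) \<le> (SUP C\<in>{C. compact C \<and> C \<subseteq> A}. ?v C)"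
          using U by (intro SUP_upper) auto
        moreover have "?v A \<le> ?v (- U) + ennreal e"
        proof -
          have "A - - U = U - - A" "- U \<subseteq> A" using U(2) by auto
          then have "?v A = ?v (- U) + ?v (U - - A)"
            using U(1) A additive[of "- U" A] by (simp add: closed_Compl)
          then show ?thesis using U(3) by (simp add: add_left_mono)
        qed
        ultimately show "?v A \<le> (SUP C\<in>{C. compact C \<and> C \<subseteq> A}. ?v C) + ennreal e"
          by (meson add_right_mono order_trans)
      qed
    qed
  qed
qed

section \<open>The Riesz theorem for bounded functionals\<close>

locale bounded_functional =
  fixes L :: "('a::t2_space \<Rightarrow>\<^sub>C real) \<Rightarrow> real" and c :: real
  assumes compact_UNIV: "compact (UNIV :: 'a set)"
    and lin: "linear L"
    and bound: "\<bar>L g\<bar> \<le> c * norm g"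
begin

lemma apply_Bcontfun: "continuous_on UNIV f \<Longrightarrow> apply_bcontfun (Bcontfun f) = f" for f :: "'a \<Rightarrow> real"
  by (rule Bcontfun_apply[OF compact_UNIV])

definition below :: "('a \<Rightarrow> real) \<Rightarrow> ('a \<Rightarrow>\<^sub>C real) set" where
  "below f = {h. \<forall>x. 0 \<le> apply_bcontfun h x \<and> apply_bcontfun h x \<le> f x}"

definition pos_part :: "('a \<Rightarrow> real) \<Rightarrow> real" where
  "pos_part f = (SUP h\<in>below f. L h)"

definition neg_part :: "('a \<Rightarrow> real) \<Rightarrow> real" where
  "neg_part f = pos_part f - L (Bcontfun f)"

lemma bound_nonneg: "0 \<le> c"
  using bound[of "const_bcontfun 1"] norm_bounded[of "const_bcontfun 1 :: 'a \<Rightarrow>\<^sub>C real"]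
  by (metis abs_ge_zero const_bcontfun.rep_eq norm_one order_trans zero_le_mult_iff zero_less_one not_one_le_zero not_le)

lemma bdd_above_below:
  assumes "continuous_on UNIV f"
  shows "bdd_above (L ` below f)"
proof (rule bdd_aboveI2)
  fix h assume h: "h \<in> below f"
  have "norm h \<le> norm (Bcontfun f)"
  proof (rule norm_bound)
    fix x
    have "norm (h x) \<le> norm (Bcontfun f x)"
      using h assms by (auto simp: below_def apply_Bcontfun) (smt (verit))
    then show "norm (h x) \<le> norm (Bcontfun f)"
      using norm_bounded[of "Bcontfun f" x] by linarith
  qed
  then have "c * norm h \<le> c * norm (Bcontfun f)"
    using bound_nonneg by (rule mult_left_mono)
  then show "L h \<le> c * norm (Bcontfun f)"
    using bound[of h] by linarith
qed

lemma below_nonempty: "(\<And>x. 0 \<le> f x) \<Longrightarrow> 0 \<in> below f"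
  by (simp add: below_def)

lemma le_pos_part: "continuous_on UNIV f \<Longrightarrow> h \<in> below f \<Longrightarrow> L h \<le> pos_part f"
  unfolding pos_part_def by (intro cSUP_upper bdd_above_below)

lemma pos_part_le: "(\<And>x. 0 \<le> f x) \<Longrightarrow> (\<And>h. h \<in> below f \<Longrightarrow> L h \<le> b) \<Longrightarrow> pos_part f \<le> b"
  unfolding pos_part_def using below_nonempty by (intro cSUP_least) auto

text \<open>
  The Riesz decomposition property: each \<open>h\<close> with \<open>0 \<le> h \<le> f + g\<close> splits as \<open>min h f\<close> plus a
  function between 0 and \<open>g\<close>.
\<close>

lemma pos_part_add:
  assumes f: "continuous_on UNIV f" "\<And>x. 0 \<le> f x" and g: "continuous_on UNIV g" "\<And>x. 0 \<le> g x"
  shows "pos_part (\<lambda>x. f x + g x) = pos_part f + pos_part g"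
proof (rule antisym)
  have fg: "continuous_on UNIV (\<lambda>x. f x + g x)" using f g by (intro continuous_intros)
  show "pos_part (\<lambda>x. f x + g x) \<le> pos_part f + pos_part g"
  proof (rule pos_part_le)
    fix h assume h: "h \<in> below (\<lambda>x. f x + g x)"
    define h1 where "h1 = Bcontfun (\<lambda>x. min (h x) (f x))"
    have h1: "h1 x = min (h x) (f x)" for x
      unfolding h1_def using f by (subst apply_Bcontfun) (auto intro!: continuous_intros)
    have "h1 \<in> below f" "h - h1 \<in> below g"
      using h f g by (auto simp: below_def h1 min_def algebra_simps)
    then have "L h1 \<le> pos_part f" "L (h - h1) \<le> pos_part g"
      using f g by (auto intro: le_pos_part)
    then show "L h \<le> pos_part f + pos_part g"
      using linear_diff[OF lin, of h h1] by linarith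
  qed (use f g in auto)
  have "pos_part f \<le> pos_part (\<lambda>x. f x + g x) - pos_part g"
  proof (rule pos_part_le[OF f(2)])
    fix h1 assume h1: "h1 \<in> below f"
    have "pos_part g \<le> pos_part (\<lambda>x. f x + g x) - L h1"
    proof (rule pos_part_le[OF g(2)])
      fix h2 assume "h2 \<in> below g"
      then have "h1 + h2 \<in> below (\<lambda>x. f x + g x)"
        using h1 by (auto simp: below_def intro: add_mono)
      then have "L (h1 + h2) \<le> pos_part (\<lambda>x. f x + g x)"
        by (rule le_pos_part[OF fg])
      then show "L h2 \<le> pos_part (\<lambda>x. f x + g x) - L h1"
        using linear_add[OF lin, of h1 h2] by linarith
    qed
    then show "L h1 \<le> pos_part (\<lambda>x. f x + g x) - pos_part g" by linarith
  qed
  then show "pos_part f + pos_part g \<le> pos_part (\<lambda>x. f x + g x)" by linarith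
qed

lemma pos_part_scale:
  assumes f: "continuous_on UNIV f" "\<And>x. 0 \<le> f x" and a: "0 \<le> a"
  shows "pos_part (\<lambda>x. a * f x) = a * pos_part f"
proof (cases "a = 0")
  case True
  have "below (\<lambda>x. 0) = {0}"
    by (auto simp: below_def intro!: bcontfun_eqI antisym)
  then show ?thesis using True linear_0[OF lin] by (simp add: pos_part_def)
next
  case False
  with a have a: "0 < a" by simp
  have le: "pos_part (\<lambda>x. b * u x) \<le> b * pos_part u"
    if u: "continuous_on UNIV u" "\<And>x. 0 \<le> u x" and b: "0 < b" for u b
  proof (rule pos_part_le)
    fix h assume h: "h \<in> below (\<lambda>x. b * u x)"
    have "(1 / b) *\<^sub>R h \<in> below u"
      using h b by (auto simp: below_def field_simps)
    then have "L ((1 / b) *\<^sub>R h) \<le> pos_part u"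
      by (rule le_pos_part[OF u(1)])
    then show "L h \<le> b * pos_part u"
      using b by (simp add: linear_scale[OF lin] field_simps)
  qed (use u b in auto)
  have "pos_part (\<lambda>x. (1 / a) * (a * f x)) \<le> (1 / a) * pos_part (\<lambda>x. a * f x)"
    using f a by (intro le continuous_intros) auto
  then have "a * pos_part f \<le> pos_part (\<lambda>x. a * f x)"
    using a by (simp add: field_simps)
  with le[OF f a] show ?thesis by linarith
qed

lemma Bcontfun_add:
  fixes f g :: "'a \<Rightarrow> real"
  assumes "continuous_on UNIV f" "continuous_on UNIV g"
  shows "Bcontfun (\<lambda>x. f x + g x) = Bcontfun f + Bcontfun g"
  using assms by (intro bcontfun_eqI) (simp add: apply_Bcontfun continuous_on_add)

lemma Bcontfun_scale:
  fixes f :: "'a \<Rightarrow> real"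
  assumes "continuous_on UNIV f"
  shows "Bcontfun (\<lambda>x. a * f x) = a *\<^sub>R Bcontfun f"
  using assms by (intro bcontfun_eqI) (simp add: apply_Bcontfun continuous_on_mult_left)

sublocale pos: positive_functional pos_part
proof
  fix f :: "'a \<Rightarrow> real" assume f: "continuous_on UNIV f" "\<And>x. 0 \<le> f x"
  show "0 \<le> pos_part f"
    using le_pos_part[OF f(1) below_nonempty[OF f(2)]] linear_0[OF lin] by simp
qed (use pos_part_add pos_part_scale compact_UNIV in auto)

sublocale neg: positive_functional neg_part
proof
  fix f g :: "'a \<Rightarrow> real"
  assume f: "continuous_on UNIV f" "\<And>x. 0 \<le> f x"
  have "Bcontfun f \<in> below f" using f by (auto simp: below_def apply_Bcontfun)
  then show "0 \<le> neg_part f"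
    using le_pos_part[OF f(1)] by (auto simp: neg_part_def)
  show "neg_part (\<lambda>x. a * f x) = a * neg_part f" if "0 \<le> a" for a
    using f that by (simp add: neg_part_def pos_part_scale Bcontfun_scale linear_scale[OF lin] algebra_simps)
  assume g: "continuous_on UNIV g" "\<And>x. 0 \<le> g x"
  show "neg_part (\<lambda>x. f x + g x) = neg_part f + neg_part g"
    using f g by (simp add: neg_part_def pos_part_add Bcontfun_add linear_add[OF lin])
qed (rule compact_UNIV)

definition representing_measure :: "'a set \<Rightarrow> real" where
  "representing_measure = measure_difference pos.riesz_measure neg.riesz_measure"

lemma outer_regular_parts: "outer_regular pos.riesz_measure" "outer_regular neg.riesz_measure"
  unfolding outer_regular_def
  using pos.riesz_outer_regular neg.riesz_outer_regular by metis+

lemma representing_measure_hahn: obtains Y where "hahn_set representing_measure Y"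
  unfolding representing_measure_def
  using hahn_set_measure_difference[OF pos.finite_riesz neg.finite_riesz] by auto

lemma regular_representing_measure: "regular_signed_measure representing_measure"
  unfolding representing_measure_def
  by (intro regular_measure_difference pos.finite_riesz neg.finite_riesz compact_UNIV outer_regular_parts) auto

text \<open>
  The parts represent \<open>L\<close> on nonnegative functions; \<open>g\<close> is made nonnegative by adding the constant
  \<open>norm g\<close>.
\<close>

lemma pairing_representing_measure: "pairing representing_measure g = L g"
proof -
  interpret p: finite_measure pos.riesz_measure by (rule pos.finite_riesz)
  interpret n: finite_measure neg.riesz_measure by (rule neg.finite_riesz)
  have m: "apply_bcontfun g \<in> borel_measurable borel"
    by (intro borel_measurable_continuous_onI) simp
  have ig: "integrable pos.riesz_measure g" "integrable neg.riesz_measure g"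
    using m norm_bounded[of g] p.integrable_const_bound[of g "norm g"] n.integrable_const_bound[of g "norm g"]
    by (simp_all add: measurable_cong_sets[OF pos.sets_riesz refl] measurable_cong_sets[OF neg.sets_riesz refl])
  have g: "continuous_on UNIV (\<lambda>x. g x + norm g)" by (intro continuous_intros) auto
  have "0 \<le> g x + norm g" for x using norm_bounded[of g x] by auto
  note gn = g this
  have one: "continuous_on UNIV (\<lambda>x::'a. 1::real)" by simp
  have "(\<integral>x. g x + norm g \<partial>pos.riesz_measure) - (\<integral>x. g x + norm g \<partial>neg.riesz_measure) = L (Bcontfun (\<lambda>x. g x + norm g))"
    using pos.riesz_integral[OF gn] neg.riesz_integral[OF gn] by (simp add: neg_part_def)
  also have "Bcontfun (\<lambda>x. g x + norm g) = g + norm g *\<^sub>R Bcontfun (\<lambda>x. 1)"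
    using gn one by (intro bcontfun_eqI) (simp add: apply_Bcontfun)
  also have "L \<dots> = L g + norm g * L (Bcontfun (\<lambda>x. 1))"
    by (simp add: linear_add[OF lin] linear_scale[OF lin])
  finally have "(\<integral>x. g x + norm g \<partial>pos.riesz_measure) - (\<integral>x. g x + norm g \<partial>neg.riesz_measure) = L g + norm g * L (Bcontfun (\<lambda>x. 1))" .
  moreover have "(\<integral>x. g x + norm g \<partial>pos.riesz_measure) = (\<integral>x. g x \<partial>pos.riesz_measure) + norm g * pos_part (\<lambda>x. 1)"
    using ig by (simp add: pos.riesz_total)
  moreover have "(\<integral>x. g x + norm g \<partial>neg.riesz_measure) = (\<integral>x. g x \<partial>neg.riesz_measure) + norm g * neg_part (\<lambda>x. 1)"
    using ig by (simp add: neg.riesz_total)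
  ultimately have "(\<integral>x. g x \<partial>pos.riesz_measure) - (\<integral>x. g x \<partial>neg.riesz_measure) = L g"
    by (simp add: neg_part_def algebra_simps)
  then show ?thesis
    unfolding representing_measure_def
    by (simp add: pairing_measure_difference pos.finite_riesz neg.finite_riesz)
qed

text \<open>
  The total masses of the two parts add up to twice the positive part at 1 minus \<open>L 1\<close>. If
  \<open>0 \<le> h \<le> 1\<close>, then \<open>2 h - 1\<close> lies in the unit ball, so \<open>2 L h - L 1 \<le> c\<close>.
\<close>

lemma variation_norm_representing_measure_le: "variation_norm representing_measure \<le> c"
proof -
  let ?one = "Bcontfun (\<lambda>x::'a. 1::real)"
  have one: "?one x = 1" for x by (simp add: apply_Bcontfun)
  have "pos_part (\<lambda>x. 1) \<le> (c + L ?one) / 2"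
  proof (rule pos_part_le)
    fix h assume h: "h \<in> below (\<lambda>x. 1)"
    have "norm (2 *\<^sub>R h - ?one) \<le> 1"
    proof (rule norm_bound)
      fix x
      have "0 \<le> h x" "h x \<le> 1" using h by (auto simp: below_def)
      then show "norm ((2 *\<^sub>R h - ?one) x) \<le> 1" by (auto simp: one abs_le_iff)
    qed
    then have "c * norm (2 *\<^sub>R h - ?one) \<le> c"
      using bound_nonneg mult_left_mono by fastforce
    then have "L (2 *\<^sub>R h - ?one) \<le> c"
      using bound[of "2 *\<^sub>R h - ?one"] by linarith
    then show "L h \<le> (c + L ?one) / 2"
      by (simp add: linear_diff[OF lin] linear_scale[OF lin])
  qed simp
  then have le: "measure pos.riesz_measure UNIV + measure neg.riesz_measure UNIV \<le> c"
    by (simp add: pos.riesz_total neg.riesz_total neg_part_def field_simps)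
  have "variation representing_measure UNIV \<le> ennreal (measure pos.riesz_measure UNIV + measure neg.riesz_measure UNIV)"
    unfolding representing_measure_def
    by (intro variation_measure_difference_le pos.finite_riesz neg.finite_riesz) auto
  also have "\<dots> \<le> ennreal c" using le by (rule ennreal_leI)
  finally show ?thesis
    unfolding variation_norm_def using bound_nonneg enn2real_leI by blast
qed

lemma representing_measure_nonneg:
  assumes "\<And>g. (\<And>x. 0 \<le> apply_bcontfun g x) \<Longrightarrow> 0 \<le> L g"
  shows "0 \<le> representing_measure A"
proof -
  interpret n: finite_measure neg.riesz_measure by (rule neg.finite_riesz)
  let ?one = "Bcontfun (\<lambda>x::'a. 1::real)"
  have one: "?one x = 1" for x by (simp add: apply_Bcontfun)
  have "pos_part (\<lambda>x. 1) \<le> L ?one"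
  proof (rule pos_part_le)
    fix h assume "h \<in> below (\<lambda>x. 1)"
    then have "0 \<le> L (?one - h)" by (intro assms) (simp add: below_def one)
    then show "L h \<le> L ?one" by (simp add: linear_diff[OF lin])
  qed simp
  then have "measure neg.riesz_measure UNIV \<le> 0"
    by (simp add: neg.riesz_total neg_part_def)
  then have "measure neg.riesz_measure A \<le> 0" 
    using n.finite_measure_mono[of A UNIV] measure_notin_sets[of A neg.riesz_measure] by (cases "A \<in> sets borel") auto
  then show ?thesis
    by (simp add: representing_measure_def measure_difference_def) (meson measure_nonneg order_trans)
qed

lemma representing_measure_in_signed_measures: "representing_measure \<in> signed_measures"
proof -
  obtain Y where "hahn_set representing_measure Y" by (rule representing_measure_hahn)
  then show ?thesis
    using regular_representing_measure by (simp add: signed_measures_def hahn_set.signed)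
qed

lemma representing_measure_UNIV: "representing_measure UNIV = L (const_bcontfun 1)"
  using linear_diff[OF lin]
  by (simp add: representing_measure_def measure_difference_def pos.riesz_total neg.riesz_total neg_part_def const_bcontfun_def)

end

section \<open>Isometries with a contractive projection onto their range\<close>

abbreviation one_bcontfun :: "'a::topological_space \<Rightarrow>\<^sub>C real" where
  "one_bcontfun \<equiv> const_bcontfun 1"

lemma norm_one_bcontfun_le: "norm (one_bcontfun :: 'a::topological_space \<Rightarrow>\<^sub>C real) \<le> 1"
  by (rule norm_bound) (simp add: const_bcontfun.rep_eq)

text \<open>
  Functions in the unit ball with value 1 at \<open>x\<close> all have images \<open>\<plusminus>1\<close> at \<open>y\<close>; the average of two of them
  is another one, so the images agree. If \<open>f\<close> lies in the unit ball and vanishes at \<open>x\<close>, then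
  \<open>u = 1 - \<bar>f\<bar>\<close> and \<open>u + f\<close> are both of this kind, which gives \<open>T f y = 0\<close>.
\<close>

lemma evaluation_of_extremal:
  fixes T :: "('l::topological_space \<Rightarrow>\<^sub>C real) \<Rightarrow> ('k::topological_space \<Rightarrow>\<^sub>C real)"
  assumes K: "compact (UNIV :: 'l set)" and lin: "linear T"
    and extremal: "\<And>f. norm f \<le> 1 \<Longrightarrow> apply_bcontfun f x = 1 \<Longrightarrow> \<bar>T f y\<bar> = 1"
  shows "T f y = T one_bcontfun y * f x"
proof -
  have one: "one_bcontfun z = (1::real)" for z :: 'l by (simp add: const_bcontfun.rep_eq)
  have peak: "T f y = T one_bcontfun y" if f: "norm f \<le> 1" "apply_bcontfun f x = 1" for f
  proof -
    have "norm ((1/2) *\<^sub>R (f + one_bcontfun)) \<le> 1"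
      using norm_triangle_ineq[of f one_bcontfun] f(1) norm_one_bcontfun_le[where 'a='l] by simp
    then have "\<bar>T ((1/2) *\<^sub>R (f + one_bcontfun)) y\<bar> = 1"
      using f by (intro extremal) (simp_all add: one)
    moreover have "\<bar>T f y\<bar> = 1" "\<bar>T one_bcontfun y\<bar> = 1"
      using f by (auto intro!: extremal norm_one_bcontfun_le simp: one)
    ultimately show ?thesis
      by (simp add: linear_scale[OF lin] linear_add[OF lin])
  qed
  have vanish: "T f y = 0" if f: "norm f \<le> 1" "apply_bcontfun f x = 0" for f
  proof -
    define u where "u = Bcontfun (\<lambda>z. 1 - \<bar>f z\<bar>)"
    have u: "u z = 1 - \<bar>f z\<bar>" for z
      unfolding u_def by (subst Bcontfun_apply[OF K]) (auto intro!: continuous_intros)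
    have le: "\<bar>f z\<bar> \<le> 1" for z using norm_bounded[of f z] f(1) by simp
    have "norm u \<le> 1" "norm (u + f) \<le> 1"
      using le by (auto intro!: norm_bound simp: u abs_le_iff) (smt (verit))+
    then have "T (u + f) y = T u y"
      using peak[of u] peak[of "u + f"] f(2) by (simp add: u)
    then show ?thesis by (simp add: linear_add[OF lin])
  qed
  define d where "d = f - f x *\<^sub>R one_bcontfun"
  have "T d y = 0"
  proof (cases "d = 0")
    case True
    then show ?thesis by (simp add: linear_0[OF lin])
  next
    case False
    have "T ((1 / norm d) *\<^sub>R d) y = 0"
      using False by (intro vanish) (simp_all add: d_def one)
    then show ?thesis using False by (simp add: linear_scale[OF lin])
  qed
  then show ?thesis
    by (simp add: d_def linear_diff[OF lin] linear_scale[OF lin])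
qed

theorem theorem5p1:
  fixes T :: "('l::t2_space \<Rightarrow>\<^sub>C real) \<Rightarrow> ('k::t2_space \<Rightarrow>\<^sub>C real)"
    and E :: "('k \<Rightarrow>\<^sub>C real) set"
    and P :: "('k \<Rightarrow>\<^sub>C real) \<Rightarrow> ('k \<Rightarrow>\<^sub>C real)"
  assumes "compact (UNIV :: 'k set)"
    and "compact (UNIV :: 'l set)"
    and "linear_isometry T"
    and "range T = E"
    and "complemented_subspace E"
    and "projection_onto E P"
    and "onorm P = 1"
  shows "\<exists>(F :: 'k set) (\<rho> :: 'k \<Rightarrow> 'l) (\<sigma> :: 'k \<Rightarrow> real) (\<phi> :: 'l \<Rightarrow> 'k set \<Rightarrow> real).
    closed F \<and>
    continuous_on F \<rho> \<and> \<rho> ` F = UNIV \<and>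
    continuous_on F \<sigma> \<and> \<sigma> ` F \<subseteq> {-1, 1} \<and>
    continuous_map euclidean (subtopology weak_star_topology (unit_sphere_on F)) \<phi> \<and>
    (\<forall>x. supp_measure (\<phi> x) \<subseteq> {y \<in> F. \<rho> y = x}) \<and>
    (\<forall>f. \<forall>y\<in>F. apply_bcontfun (T f) y = \<sigma> y * apply_bcontfun f (\<rho> y)) \<and>
    (\<forall>g. \<forall>y\<in>F. apply_bcontfun (P g) y = \<sigma> y * pairing (\<phi> (\<rho> y)) g) \<and>
    (positive_operator T \<longrightarrow> (\<forall>y\<in>F. \<sigma> y = 1)) \<and>
    (positive_operator T \<and> positive_operator P \<longrightarrow> (\<forall>x. \<phi> x \<in> prob_measures_on F))"
proof -
  note compK = assms(1) and compL = assms(2)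
  have lin: "linear T" and iso: "norm (T f) = norm f" for f
    using assms(3) by (auto simp: linear_isometry_def)
  have injT: "inj T"
    using iso linear_injective_0[OF lin] by (metis norm_eq_zero)
  have P: "bounded_linear P" "P g \<in> range T" "P (T f) = T f" for g f
    using assms(4,6) by (auto simp: projection_onto_def)
  define S where "S g = inv T (P g)" for g
  have TS: "T (S g) = P g" for g
    unfolding S_def using P(2) by (rule f_inv_into_f)
  have ST: "S (T f) = f" for f
    unfolding S_def P(3) using injT by simp
  have linS: "linear S"
  proof
    interpret P: bounded_linear P by (rule P(1))
    show "S (f + g) = S f + S g" for f g
      by (rule injD[OF injT]) (simp add: TS linear_add[OF lin] P.add)
    show "S (a *\<^sub>R f) = a *\<^sub>R S f" for a f
      by (rule injD[OF injT]) (simp add: TS linear_scale[OF lin] P.scale)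
  qed
  have normS: "norm (S g) \<le> norm g" for g
    using onorm[OF P(1), of g] assms(7) by (simp add: TS flip: iso)
  have bf: "bounded_functional (\<lambda>g. S g x) 1" for x
  proof (rule bounded_functional.intro)
    show "linear (\<lambda>g. S g x)"
      by (rule linearI) (simp_all add: linear_add[OF linS] linear_scale[OF linS])
    show "\<bar>S g x\<bar> \<le> 1 * norm g" for g
      using norm_bounded[of "S g" x] normS[of g] by simp
  qed (rule compK)
  define \<phi> where "\<phi> x = bounded_functional.representing_measure (\<lambda>g. S g x)" for x
  note \<phi>_pairing = bounded_functional.pairing_representing_measure[OF bf, folded \<phi>_def]
  note \<phi>_regular = bounded_functional.regular_representing_measure[OF bf, folded \<phi>_def]
  note \<phi>_signed = bounded_functional.representing_measure_in_signed_measures[OF bf, folded \<phi>_def]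
  have one [simp]: "one_bcontfun x = (1::real)" for x :: "'b::topological_space"
    by (simp add: const_bcontfun.rep_eq)
  have \<phi>_hahn: "\<exists>Y. hahn_set (\<phi> x) Y" for x
    using bounded_functional.representing_measure_hahn[OF bf] unfolding \<phi>_def by blast
  have \<phi>_norm: "variation_norm (\<phi> x) = 1" for x
  proof (rule antisym)
    show "variation_norm (\<phi> x) \<le> 1"
      unfolding \<phi>_def by (rule bounded_functional.variation_norm_representing_measure_le[OF bf])
    obtain Y where "hahn_set (\<phi> x) Y" using \<phi>_hahn by blast
    then have "pairing (\<phi> x) (T one_bcontfun) \<le> variation_norm (\<phi> x)"
      by (rule hahn_set.pairing_le_variation_norm) (simp add: iso norm_one_bcontfun_le)
    then show "1 \<le> variation_norm (\<phi> x)"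
      by (simp add: \<phi>_pairing ST)
  qed
  \<comment> \<open>The graph of \<open>\<rho>\<close>.\<close>
  define G where "G = {p. \<bar>T one_bcontfun (fst p)\<bar> = 1 \<and> (\<forall>f. T f (fst p) = T one_bcontfun (fst p) * apply_bcontfun f (snd p))}"
  have "closed G"
  proof -
    have c: "continuous_on UNIV (\<lambda>p. apply_bcontfun g (fst p))" "continuous_on UNIV (\<lambda>p. apply_bcontfun f (snd p))"
      for g :: "'k \<Rightarrow>\<^sub>C real" and f :: "'l \<Rightarrow>\<^sub>C real"
      using continuous_on_compose2[OF continuous_on_apply_bcontfun[of UNIV g] continuous_on_fst[OF continuous_on_id, of UNIV]]
        continuous_on_compose2[OF continuous_on_apply_bcontfun[of UNIV f] continuous_on_snd[OF continuous_on_id, of UNIV]]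
      by simp_all
    have "closed {p. \<bar>T one_bcontfun (fst p)\<bar> = 1}"
      by (intro closed_Collect_eq continuous_intros c)
    moreover have "closed {p. T f (fst p) = T one_bcontfun (fst p) * apply_bcontfun f (snd p)}" for f
      by (intro closed_Collect_eq continuous_intros c)
    ultimately show ?thesis
      unfolding G_def by (intro closed_Collect_conj closed_Collect_all)
  qed
  then have compG: "compact G"
    using compact_Int_closed[OF compact_Times[OF compK compL], of G] by simp
  have unique: "x = x'" if "(y, x) \<in> G" "(y, x') \<in> G" for y x x'
  proof (rule ccontr)
    assume "x \<noteq> x'"
    then have "{x} \<inter> {x'} = {}" by simp
    then obtain h :: "'l \<Rightarrow> real" where h: "continuous_on UNIV h" "\<And>z. 0 \<le> h z" "\<And>z. h z \<le> 1"
        "\<And>z. z \<in> {x} \<Longrightarrow> h z = 0" "\<And>z. z \<in> {x'} \<Longrightarrow> h z = 1"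
      by (rule compact_separating_function[OF compL closed_singleton closed_singleton]) blast
    have "apply_bcontfun (Bcontfun h) x = 0" "apply_bcontfun (Bcontfun h) x' = 1"
      using h(4,5) by (simp_all add: Bcontfun_apply[OF compL h(1)])
    moreover have "T u y = T one_bcontfun y * u x" "T u y = T one_bcontfun y * u x'" for u
      using that unfolding G_def mem_Collect_eq fst_conv snd_conv by blast+
    then have "T one_bcontfun y * apply_bcontfun u x = T one_bcontfun y * apply_bcontfun u x'" for u
      by metis
    moreover have "\<bar>T one_bcontfun y\<bar> = 1"
      using that unfolding G_def mem_Collect_eq fst_conv by blast
    ultimately show False
      by (metis abs_zero mult_cancel_left zero_neq_one)
  qed
  define F where "F = fst ` G"
  define \<rho> where "\<rho> y = snd (inv_into G fst y)" for y
  define \<sigma> where "\<sigma> = apply_bcontfun (T one_bcontfun)"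
  have inj: "inj_on fst G"
    using unique by (auto simp: inj_on_def)
  have cont_\<rho>: "continuous_on F \<rho>"
  proof -
    have "continuous_on (fst ` G) (inv_into G fst)"
      using inj by (intro continuous_on_inv compG continuous_intros) simp
    then show ?thesis unfolding F_def \<rho>_def by (intro continuous_intros)
  qed
  have closed_F: "closed F"
    unfolding F_def by (intro compact_imp_closed compact_continuous_image compG continuous_intros)
  have graph: "(y, x) \<in> G \<longleftrightarrow> y \<in> F \<and> \<rho> y = x" for y x
  proof
    assume "(y, x) \<in> G"
    then show "y \<in> F \<and> \<rho> y = x"
      using inv_into_f_f[OF inj, of "(y, x)"] by (force simp: F_def \<rho>_def)
  next
    assume *: "y \<in> F \<and> \<rho> y = x"
    then have "inv_into G fst y \<in> G" "fst (inv_into G fst y) = y"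
      unfolding F_def by (auto intro: inv_into_into f_inv_into_f)
    then show "(y, x) \<in> G"
      using * unfolding \<rho>_def by (metis prod.collapse)
  qed
  have T_eq: "T f y = \<sigma> y * apply_bcontfun f (\<rho> y)" and \<sigma>1: "\<bar>\<sigma> y\<bar> = 1" if "y \<in> F" for f y
  proof -
    have "(y, \<rho> y) \<in> G" using graph that by blast
    then show "T f y = \<sigma> y * apply_bcontfun f (\<rho> y)" "\<bar>\<sigma> y\<bar> = 1"
      unfolding G_def \<sigma>_def mem_Collect_eq fst_conv snd_conv by blast+
  qed
  have supp: "supp_measure (\<phi> x) \<subseteq> {y \<in> F. \<rho> y = x}" and supp_ne: "supp_measure (\<phi> x) \<noteq> {}" for x
  proof -
    obtain Y where "hahn_set (\<phi> x) Y" using \<phi>_hahn by blast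
    then interpret hahn_set "\<phi> x" Y .
    note supp_props = supp_measure_properties[OF \<phi>_regular]
    show "supp_measure (\<phi> x) \<noteq> {}"
      using supp_props(2) \<phi>_norm[of x] by (auto simp: variation_norm_def)
    have "(y, x) \<in> G" if y: "y \<in> supp_measure (\<phi> x)" for y
    proof -
      \<comment> \<open>Since \<open>\<phi> x\<close> attains its norm at \<open>T f\<close>, the set where \<open>\<bar>T f\<bar> < 1\<close> is an open null set and misses the support.\<close>
      have extremal: "\<bar>T f y\<bar> = 1" if f: "norm f \<le> 1" "apply_bcontfun f x = 1" for f
      proof (rule ccontr)
        assume "\<bar>T f y\<bar> \<noteq> 1"
        moreover have "\<bar>T f y\<bar> \<le> 1" using norm_bounded[of "T f" y] f(1) iso[of f] by simp
        ultimately have "y \<in> {z. \<bar>T f z\<bar> < 1}" by simp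
        moreover have "variation (\<phi> x) {z. \<bar>T f z\<bar> < 1} = 0"
          using f by (intro variation_null_of_norming) (simp_all add: iso \<phi>_pairing ST \<phi>_norm)
        moreover have "open {z. \<bar>T f z\<bar> < 1}"
          by (intro open_Collect_less continuous_intros) auto
        ultimately show False
          using supp_props(3)[of "- {z. \<bar>T f z\<bar> < 1}"] y by auto
      qed
      then have "T f y = T one_bcontfun y * f x" for f
        by (intro evaluation_of_extremal[OF compL lin])
      moreover have "\<bar>T one_bcontfun y\<bar> = 1"
        by (rule extremal) (simp_all add: norm_one_bcontfun_le)
      ultimately show ?thesis
        unfolding G_def mem_Collect_eq fst_conv snd_conv by blast
    qed
    then show "supp_measure (\<phi> x) \<subseteq> {y \<in> F. \<rho> y = x}"
      using graph by auto
  qed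
  have onto: "\<exists>y\<in>F. \<rho> y = x" for x
    using supp[of x] supp_ne[of x] by blast
  have \<phi>_on: "\<phi> x \<in> signed_measures_on F" for x
    using \<phi>_signed supp[of x] by (auto simp: signed_measures_on_def)
  have cont_\<phi>: "continuous_map euclidean (subtopology weak_star_topology (unit_sphere_on F)) \<phi>"
    unfolding continuous_map_in_subtopology weak_star_topology_def
  proof (intro conjI continuous_map_pullback')
    show "continuous_map euclidean (powertop_real UNIV) (pairing \<circ> \<phi>)"
      by (simp add: continuous_map_componentwise_UNIV \<phi>_pairing)
    show "topspace euclidean \<subseteq> \<phi> -` signed_measures"
      using \<phi>_signed by auto
    show "\<phi> \<in> topspace euclidean \<rightarrow> unit_sphere_on F"
      using \<phi>_on \<phi>_norm by (auto simp: unit_sphere_on_def)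
  qed
  have \<sigma>_pos: "\<sigma> y = 1" if "positive_operator T" "y \<in> F" for y
  proof -
    have "0 \<le> \<sigma> y" using that(1) by (simp add: positive_operator_def \<sigma>_def)
    then show ?thesis using \<sigma>1[OF that(2)] by simp
  qed
  have prob: "\<phi> x \<in> prob_measures_on F" if pos: "positive_operator T" "positive_operator P" for x
  proof -
    have S_pos: "0 \<le> S g x" if g: "\<And>y. 0 \<le> apply_bcontfun g y" for g
    proof -
      obtain y where y: "y \<in> F" "\<rho> y = x" using onto by blast
      then have "S g x = P g y"
        using T_eq[of y "S g"] \<sigma>_pos[OF pos(1), of y] by (simp add: TS)
      then show ?thesis using pos(2) g by (simp add: positive_operator_def)
    qed
    have "0 \<le> \<phi> x A" for A
      unfolding \<phi>_def by (rule bounded_functional.representing_measure_nonneg[OF bf S_pos])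
    moreover have "\<phi> x UNIV = 1"
    proof -
      have "\<phi> x UNIV = S one_bcontfun x"
        unfolding \<phi>_def by (rule bounded_functional.representing_measure_UNIV[OF bf])
      also have "\<dots> = 1"
      \<comment> \<open>The lower bound comes from \<open>T 1 \<le> 1\<close>, where \<open>S (T 1) = 1\<close>.\<close>
      proof (rule antisym)
        have le: "\<bar>T one_bcontfun y\<bar> \<le> 1" for y
          using norm_bounded[of "T one_bcontfun" y] iso[of one_bcontfun] norm_one_bcontfun_le[where 'a='l] by simp
        have "0 \<le> S (one_bcontfun - T one_bcontfun) x"
          using le by (intro S_pos) (simp add: abs_le_iff)
        then show "1 \<le> S one_bcontfun x" by (simp add: linear_diff[OF linS] ST)
        show "S one_bcontfun x \<le> 1"
          using norm_bounded[of "S one_bcontfun" x] normS[of one_bcontfun] norm_one_bcontfun_le[where 'a='k] by simp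
      qed
      finally show ?thesis .
    qed
    ultimately show ?thesis using \<phi>_on by (simp add: prob_measures_on_def)
  qed
  show ?thesis
  proof (intro exI[of _ F] exI[of _ \<rho>] exI[of _ \<sigma>] exI[of _ \<phi>] conjI allI ballI impI)
    show "\<rho> ` F = UNIV" using onto by (metis UNIV_eq_I imageI)
    show "continuous_on F \<sigma>" by (simp add: \<sigma>_def)
    show "\<sigma> ` F \<subseteq> {-1, 1}" using \<sigma>1 by (force simp: abs_if split: if_splits)
    show "P g y = \<sigma> y * pairing (\<phi> (\<rho> y)) g" if "y \<in> F" for g y
      using T_eq[OF that, of "S g"] by (simp add: TS \<phi>_pairing)
  qed (use closed_F cont_\<rho> cont_\<phi> supp T_eq \<sigma>_pos prob in auto)
qed

end
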